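(* Let $(Y_t)_{t\in\mathbb Z}$ and $(X_t)_{t\in\mathbb Z}$ be stationary real-valued time series with $Y_t=\Phi(Y_{t-1},\epsilon_t)$ and $X_t=\Psi(Y_t,\epsilon_{t+1},\dots,\epsilon_{t+s})$, $t\in\mathbb Z$, in the setting described in the context, and let Conditions 1 and 2 (see context) hold. Then the following are equivalent: (i) for all integers $m\le n$ the weak accumulation point, as $x\to\infty$, of $$\mathcal L\left(\frac{Y_m}{x},\dots,\frac{Y_n}{x}\;\middle|\;|X_0|>x\right)$$ is unique, and the limit law $\mathcal L(Y_0^{(X)}):=\lim_{x\to\infty}\mathcal L(Y_0/x\mid |X_0|>x)$ has no mass in zero; (ii) there exists a weak accumulation point $\mathcal L(\hat Y_0^{(X)})$ of $\mathcal L(Y_0/x\mid |X_0|>x)$ as $x\to\infty$ with $\hat Y_0^{(X)}\ne 0$ almost surely.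
   Context: Setting: $s\ge 1$ is an integer, $\mathbb S$ is a separable metric space with its Borel $\sigma$-algebra, $(\epsilon_t)_{t\in\mathbb Z}$ is an i.i.d. sequence of $\mathbb S$-valued random variables, $\Phi:\mathbb R\times\mathbb S\to\mathbb R$ and $\Psi:\mathbb R\times\mathbb S^{s}\to\mathbb R$ are measurable, and for every $r\in\mathbb Z$ the innovations $(\epsilon_t)_{t>r}$ are independent of $(Y_t)_{t\le r}$. Convention: $\operatorname{sign}(w)=1$ if $w\ge 0$ and $-1$ if $w<0$. Condition 1: there are $\alpha>0$, $p,p'\in[0,1]$ and $C\in(0,\infty)$ with (1.a) $\lim_{x\to\infty}P(|Y_0|>ux)/P(|Y_0|>x)=u^{-\alpha}$ for all $u>0$ and $\lim_{x\to\infty}P(Y_0>x)/P(|Y_0|>x)=p$; (1.b) $\lim_{x\to\infty}P(|X_0|>ux)/P(|X_0|>x)=u^{-\alpha}$ for all $u>0$ and $\lim_{x\to\infty}P(X_0>x)/P(|X_0|>x)=p'$; and $\lim_{x\to\infty}P(|X_0|>x)/P(|Y_0|>x)=C$. Condition 2: (2.a) there is a function $\phi:\mathbb S\times\{-1,1\}\to\mathbb R$ such that $\lim_{y\to\infty}\Phi(y\,w(y),v(y))/y=w\,\phi(v,\operatorname{sign}(w))$ whenever $w(y)\to w\in\mathbb R$ and $v(y)\to v\in\mathbb S$; (2.b) there is a function $\psi:\mathbb S^s\times\{-1,1\}\to\mathbb R$ such that $\lim_{y\to\infty}\Psi(y\,w(y),v(y))/y=w\,\psi(v,\operatorname{sign}(w))$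 whenever $w(y)\to w\in\mathbb R$ and $v(y)\to v\in\mathbb S^s$. A weak accumulation point of a family of laws $(\mu_x)$ as $x\to\infty$ is a probability measure that is the weak limit of $\mu_{x_k}$ for some sequence $x_k\to\infty$. *)

theory Defs
  imports "HOL-Probability.Probability"
begin

definition sign_pm :: "real \<Rightarrow> real" where
  "sign_pm w = (if w \<ge> 0 then 1 else - 1)"

text \<open>Strict stationarity: invariance of all finite-dimensional distributions under time shifts.\<close>

definition stationary :: "'a measure \<Rightarrow> (int \<Rightarrow> 'a \<Rightarrow> real) \<Rightarrow> bool" where
  "stationary M Z \<longleftrightarrow>
     (\<forall>J h. finite J \<longrightarrow>
        distr M (\<Pi>\<^sub>M t\<in>J. borel) (\<lambda>\<omega>. \<lambda>t\<in>J. Z (t + h) \<omega>) =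
        distr M (\<Pi>\<^sub>M t\<in>J. borel) (\<lambda>\<omega>. \<lambda>t\<in>J. Z t \<omega>))"

definition iid :: "'a measure \<Rightarrow> (int \<Rightarrow> 'a \<Rightarrow> 's::topological_space) \<Rightarrow> bool" where
  "iid M \<epsilon> \<longleftrightarrow>
     prob_space.indep_vars M (\<lambda>_. borel) \<epsilon> UNIV \<and>
     (\<forall>t. distr M borel (\<epsilon> t) = distr M borel (\<epsilon> 0))"

text \<open>The \<open>\<sigma>\<close>-algebra on the sample space generated by the variables \<open>Z t\<close>, \<open>t \<in> T\<close>.
  (\<open>prob_space.indep_var\<close> would force both variables to have the same value type, so independence
  of two families is expressed through their generated \<open>\<sigma>\<close>-algebras.)\<close>

definition generated_events ::
    "'a measure \<Rightarrow> int set \<Rightarrow> (int \<Rightarrow> 'a \<Rightarrow> 'b::topological_space) \<Rightarrow> 'a set set" where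
  "generated_events M T Z =
     sets (vimage_algebra (space M) (\<lambda>\<omega>. \<lambda>t\<in>T. Z t \<omega>) (\<Pi>\<^sub>M t\<in>T. borel))"

definition innovations_indep_past ::
    "'a measure \<Rightarrow> (int \<Rightarrow> 'a \<Rightarrow> 's::topological_space) \<Rightarrow> (int \<Rightarrow> 'a \<Rightarrow> real) \<Rightarrow> bool" where
  "innovations_indep_past M \<epsilon> Y \<longleftrightarrow>
     (\<forall>r. prob_space.indep_set M (generated_events M {r<..} \<epsilon>) (generated_events M {..r} Y))"

definition balanced_regularly_varying ::
    "'a measure \<Rightarrow> ('a \<Rightarrow> real) \<Rightarrow> real \<Rightarrow> real \<Rightarrow> bool" where
  "balanced_regularly_varying M Z \<alpha> p \<longleftrightarrow>
     (\<forall>u>0. ((\<lambda>x. measure M {\<omega> \<in> space M. \<bar>Z \<omega>\<bar> > u * x} / measure M {\<omega> \<in> space M. \<bar>Z \<omega>\<bar> > x})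
               \<longlongrightarrow> u powr (- \<alpha>)) at_top) \<and>
     ((\<lambda>x. measure M {\<omega> \<in> space M. Z \<omega> > x} / measure M {\<omega> \<in> space M. \<bar>Z \<omega>\<bar> > x})
        \<longlongrightarrow> p) at_top"

text \<open>\<open>F\<close> has scaling limit \<open>f\<close>; the second argument ranges over the topological space \<open>T\<close>, and the
  sign argument of \<open>f\<close> is only ever \<open>1\<close> or \<open>- 1\<close>.\<close>

definition scaling_limit ::
    "'b topology \<Rightarrow> (real \<Rightarrow> 'b \<Rightarrow> real) \<Rightarrow> ('b \<Rightarrow> real \<Rightarrow> real) \<Rightarrow> bool" where
  "scaling_limit T F f \<longleftrightarrow>
     (\<forall>w v w0 v0. (w \<longlongrightarrow> w0) at_top \<longrightarrow> limitin T v v0 at_top \<longrightarrow>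
        ((\<lambda>y. F (y * w y) (v y) / y) \<longlongrightarrow> w0 * f v0 (sign_pm w0)) at_top)"

text \<open>Weak convergence along a filter \<open>G\<close> of laws on a topological space \<open>T\<close>, tested against bounded
  continuous functions.  The \<open>\<sigma>\<close>-algebra of the limit \<open>\<nu>\<close> is fixed by the laws themselves, so that
  limits are unique as measures.\<close>

definition weak_limit ::
    "'b topology \<Rightarrow> 'b measure \<Rightarrow> ('i \<Rightarrow> 'b measure) \<Rightarrow> 'b measure \<Rightarrow> 'i filter \<Rightarrow> bool" where
  "weak_limit T N \<mu> \<nu> G \<longleftrightarrow>
     prob_space \<nu> \<and> sets \<nu> = sets N \<and>
     (\<forall>f. continuous_map T euclideanreal f \<longrightarrow> bounded (f ` topspace T) \<longrightarrow>
        ((\<lambda>i. integral\<^sup>L (\<mu> i) f) \<longlongrightarrow> integral\<^sup>L \<nu> f) G)"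

text \<open>On the real line this is the library's weak convergence of distribution functions.\<close>

lemma weak_limit_real_iff:
  assumes "\<And>k. real_distribution (\<mu> k)" "real_distribution \<nu>"
  shows "weak_limit euclidean borel \<mu> \<nu> sequentially \<longleftrightarrow> weak_conv_m \<mu> \<nu>"
proof
  assume L: "weak_limit euclidean borel \<mu> \<nu> sequentially"
  show "weak_conv_m \<mu> \<nu>"
  proof (rule integral_bdd_continuous_conv_imp_weak_conv)
    fix f :: "real \<Rightarrow> real"
    assume "\<And>x. isCont f x" and b: "\<And>x. \<bar>f x\<bar> \<le> 1"
    then have "continuous_on UNIV f"
      by (simp add: continuous_at_imp_continuous_on)
    moreover have "bounded (range f)"
      using b by (intro boundedI[of _ 1]) auto
    ultimately show "(\<lambda>n. integral\<^sup>L (\<mu> n) f) \<longlonglongrightarrow> integral\<^sup>L \<nu> f"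
      using L by (simp add: weak_limit_def)
  qed (use assms in auto)
next
  assume W: "weak_conv_m \<mu> \<nu>"
  have "(\<lambda>n. integral\<^sup>L (\<mu> n) f) \<longlonglongrightarrow> integral\<^sup>L \<nu> f"
    if c: "continuous_map euclidean euclideanreal f" and b: "bounded (range f)" for f :: "real \<Rightarrow> real"
  proof -
    obtain B where "\<And>x. norm (f x) \<le> B"
      using b unfolding bounded_iff by blast
    moreover have "\<And>x. isCont f x"
      using c by (simp add: continuous_on_eq_continuous_at)
    ultimately show ?thesis
      by (intro weak_conv_imp_integral_bdd_continuous_conv[OF assms W])
  qed
  moreover have "prob_space \<nu>" "sets \<nu> = sets borel"
    using assms(2) by (simp_all add: real_distribution_def real_distribution_axioms_def)
  ultimately show "weak_limit euclidean borel \<mu> \<nu> sequentially"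
    by (simp add: weak_limit_def)
qed

definition weak_accumulation_point ::
    "'b topology \<Rightarrow> 'b measure \<Rightarrow> (real \<Rightarrow> 'b measure) \<Rightarrow> 'b measure \<Rightarrow> bool" where
  "weak_accumulation_point T N \<mu> \<nu> \<longleftrightarrow>
     (\<exists>x :: nat \<Rightarrow> real. filterlim x at_top sequentially \<and>
        weak_limit T N (\<lambda>k. \<mu> (x k)) \<nu> sequentially)"

text \<open>The spaces \<open>\<real>\<^bsup>I\<^esup>\<close> and \<open>S\<^bsup>I\<^esup>\<close> for a finite index set \<open>I\<close> are modelled by functions
  on \<open>I\<close> that are \<open>undefined\<close> elsewhere; as the factors are second countable, the Borel
  \<open>\<sigma>\<close>-algebra of the product topology is the product \<open>\<sigma>\<close>-algebra.\<close>

abbreviation power_top :: "'i set \<Rightarrow> ('i \<Rightarrow> 'b::topological_space) topology" where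
  "power_top I \<equiv> product_topology (\<lambda>_. euclidean) I"

abbreviation power_borel :: "'i set \<Rightarrow> ('i \<Rightarrow> 'b::topological_space) measure" where
  "power_borel I \<equiv> (\<Pi>\<^sub>M i\<in>I. borel)"

text \<open>Conditional law of \<open>Z\<close> (with values in \<open>N\<close>) given \<open>\<bar>V\<bar> > x\<close>.\<close>

definition law_given_exceedance ::
    "'a measure \<Rightarrow> 'b measure \<Rightarrow> ('a \<Rightarrow> 'b) \<Rightarrow> ('a \<Rightarrow> real) \<Rightarrow> real \<Rightarrow> 'b measure" where
  "law_given_exceedance M N Z V x =
     distr (uniform_measure M {\<omega> \<in> space M. \<bar>V \<omega>\<bar> > x}) N Z"

end

theory Submission
  imports Defs
begin

text \<open>
  The content is that (ii) implies (i). Started at a time \<open>j \<le> 0\<close>, the rescaled path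
  \<open>(Y\<^sub>j, \<dots>, Y\<^sub>n) / x\<close> and \<open>X\<^sub>0 / x\<close> are functions of \<open>Y\<^sub>j / x\<close> and of independent innovations
  which converge continuously as \<open>x \<rightarrow> \<infinity>\<close>. Regular variation of \<open>Y\<^sub>j\<close> therefore gives, for every
  \<open>\<eta> > 0\<close>, a limit of the conditional law restricted to \<open>\<bar>Y\<^sub>j\<bar> > \<eta> x\<close>, integrals over the innovations
  being treated pointwise by dominated convergence. For \<open>j = 0\<close> an accumulation point without mass
  in zero forces these limits to exhaust the total mass one as \<open>\<eta> \<rightarrow> 0\<close>.
  For \<open>j < 0\<close>, replacing \<open>Y\<^sub>j\<close> by zero on \<open>\<bar>Y\<^sub>j\<bar> \<le> \<eta> x\<close> changes the integral of a Lipschitz function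
  by \<open>O(\<eta>)\<close>, so that the limit for the window starting at \<open>j\<close> is obtained from the one starting
  at \<open>j + 1\<close>: if \<open>A\<close> is the limit on \<open>y\<^sub>j \<noteq> 0\<close>, \<open>z\<close> sets the coordinate \<open>j\<close> to zero and \<open>L'\<close> is the limit
  for \<open>j + 1\<close>, then the limit for \<open>j\<close> is \<open>A + (L' - z\<^sub>* A)\<close>. No compactness is needed.
\<close>

section \<open>Weak limits\<close>

text \<open>The obstacle is that freezing the innovations hides those of order x. A path that is
  negligible at time j can be driven to size x later by one such innovation, and the continuous
  limits, under which zero stays zero, say nothing about it. So for j < 0 the limit law may charge
  y_j = 0, and that part is reached only as a difference: the law from time j + 1 on counts all
  paths, those with y_j nonzero are known, and on the rest the window is determined by its later
  coordinates. At j = 0 statement (ii) excludes such paths. Having (ii) along a single sequence is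
  enough, because the limits on |Y_0| > \<eta> x exist along all x; the sequence only decides their
  total mass. Integrals are normalised by P(|X_0| > x) throughout, so that conditional expectations
  are plain quotients and C is absorbed into the tail constants p / C and (1 - p) / C. The
  exceedance of X_0 enters as a discontinuous factor; homogeneity of the limit maps makes its
  boundary null for each fixed sequence of innovations.\<close>

lemma tendsto_of_approximations:
  fixes h :: "'i \<Rightarrow> real"
  assumes "\<And>e. e > 0 \<Longrightarrow> \<exists>g l'. (g \<longlongrightarrow> l') F \<and> (\<forall>\<^sub>F i in F. \<bar>h i - g i\<bar> \<le> e) \<and> \<bar>l' - l\<bar> \<le> e"
  shows "(h \<longlongrightarrow> l) F"
proof (rule tendstoI)
  fix e :: real assume "e > 0"
  then obtain g l' where g: "(g \<longlongrightarrow> l') F" "\<forall>\<^sub>F i in F. \<bar>h i - g i\<bar> \<le> e/4" "\<bar>l' - l\<bar> \<le> e/4"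
    using assms[of "e/4"] by auto
  have "\<forall>\<^sub>F i in F. dist (g i) l' < e/4"
    by (rule tendstoD[OF g(1)]) (use \<open>e > 0\<close> in simp)
  with g(2) show "\<forall>\<^sub>F i in F. dist (h i) l < e"
    by eventually_elim (use g(3) \<open>e > 0\<close> in \<open>unfold dist_real_def, linarith\<close>)
qed

lemma abs_integral_le:
  fixes f :: "'b \<Rightarrow> real"
  assumes "integrable N f" "integrable N g" "\<And>x. x \<in> space N \<Longrightarrow> \<bar>f x\<bar> \<le> g x"
  shows "\<bar>integral\<^sup>L N f\<bar> \<le> integral\<^sup>L N g"
proof -
  have "\<bar>integral\<^sup>L N f\<bar> \<le> (\<integral>x. \<bar>f x\<bar> \<partial>N)"
    using integral_norm_bound[of N f] by simp
  also have "\<dots> \<le> integral\<^sup>L N g"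
    using assms by (intro integral_mono) auto
  finally show ?thesis .
qed

lemma bounded_borel_integrable:
  fixes f :: "'b \<Rightarrow> real"
  assumes "finite_measure L" "f \<in> borel_measurable L" "bounded (range f)"
  shows "integrable L f"
proof -
  obtain B where "\<And>x. norm (f x) \<le> B"
    using assms(3) by (auto simp: bounded_iff)
  then show ?thesis
    using assms by (intro finite_measure.integrable_const_bound[of _ _ B]) auto
qed

lemma continuous_bounded_integrable:
  fixes f :: "'b::topological_space \<Rightarrow> real"
  assumes "finite_measure L" "sets L = sets borel" "continuous_on UNIV f" "bounded (range f)"
  shows "integrable L f"
  using assms borel_measurable_continuous_onI[of f]
  by (intro bounded_borel_integrable) (simp_all cong: measurable_cong_sets)

text \<open>The infimal convolution \<open>inf\<^sub>y (f y + k * dist x y)\<close> is \<open>k\<close>-Lipschitz and increases to \<open>f\<close>.\<close>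

lemma lipschitz_minorants:
  fixes f :: "'b::metric_space \<Rightarrow> real"
  assumes "continuous_on UNIV f" and B: "\<And>x. \<bar>f x\<bar> \<le> B"
  obtains g where "\<And>k::nat. (real k)-lipschitz_on UNIV (g k)" "\<And>k x. g k x \<le> f x"
    "\<And>k x. \<bar>g k x\<bar> \<le> B" "\<And>x. (\<lambda>k. g k x) \<longlonglongrightarrow> f x"
proof -
  define g where "g k x = (INF y. f y + real k * dist x y)" for k :: nat and x
  have nn: "- B \<le> f y + real k * dist x y" for k x y
    using B[of y] by (smt (verit) mult_nonneg_nonneg of_nat_0_le_iff zero_le_dist)
  then have bdd: "bdd_below (range (\<lambda>y. f y + real k * dist x y))" for k x
    by (auto simp: bdd_below_def)
  have le: "g k x \<le> f y + real k * dist x y" for k x y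
    unfolding g_def by (rule cINF_lower[OF bdd]) simp
  have ge: "c \<le> g k x" if "\<And>y. c \<le> f y + real k * dist x y" for c k x
    unfolding g_def using that by (intro cINF_greatest) auto
  have gf: "g k x \<le> f x" for k x
    using le[of k x x] by simp
  have gB: "\<bar>g k x\<bar> \<le> B" for k x
    using gf[of k x] ge[of "-B", OF nn, of k x] B[of x] by auto
  have half: "g k x - real k * dist x x' \<le> g k x'" for k x x'
  proof (rule ge)
    fix y
    have "real k * dist x y \<le> real k * (dist x x' + dist x' y)"
      by (intro mult_left_mono dist_triangle) auto
    then show "g k x - real k * dist x x' \<le> f y + real k * dist x' y"
      using le[of k x y] by (simp add: algebra_simps)
  qed
  have lip: "(real k)-lipschitz_on UNIV (g k)" for k
  proof (rule lipschitz_onI)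
    fix x x'
    show "dist (g k x) (g k x') \<le> real k * dist x x'"
      using half[of k x x'] half[of k x' x] by (auto simp: dist_real_def dist_commute abs_le_iff)
  qed simp
  have lim: "(\<lambda>k. g k x) \<longlonglongrightarrow> f x" for x
  proof (rule tendstoI)
    fix e :: real assume e: "e > 0"
    have "isCont f x"
      using assms(1) by (simp add: continuous_on_eq_continuous_at)
    then obtain d where d: "d > 0" "\<And>y. dist y x < d \<Longrightarrow> dist (f y) (f x) < e/2"
      unfolding continuous_at_eps_delta using e by (metis half_gt_zero)
    have "\<forall>\<^sub>F k in sequentially. real k \<ge> 2 * B / d"
      by real_asymp
    then show "\<forall>\<^sub>F k in sequentially. dist (g k x) (f x) < e"
    proof eventually_elim
      case (elim k)
      have "f x - e/2 \<le> g k x"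
      proof (rule ge)
        fix y
        show "f x - e/2 \<le> f y + real k * dist x y"
        proof (cases "dist y x < d")
          case True
          then show ?thesis
            using d(2)[of y] mult_nonneg_nonneg[OF of_nat_0_le_iff zero_le_dist[of x y], of k]
            unfolding dist_real_def by linarith
        next
          case False
          have "2 * B \<le> real k * d"
            using elim d(1) by (simp add: divide_simps mult.commute)
          also have "\<dots> \<le> real k * dist x y"
            using False by (intro mult_left_mono) (auto simp: dist_commute)
          finally show ?thesis
            using B[of x] B[of y] e by (auto simp: abs_le_iff)
        qed
      qed
      then show ?case
        using gf[of k x] e by (auto simp: dist_real_def)
    qed
  qed
  show ?thesis
    using that lip gf gB lim by blast
qed

text \<open>Minorants suffice: they bound the lower limit of the integrals of f from below, and the
  same bound for -f controls the upper limit. The reduction is wanted because truncation errors are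
  controlled only for Lipschitz test functions.\<close>

lemma weak_limit_if_lipschitz:
  fixes \<mu> :: "'i \<Rightarrow> 'b::metric_space measure"
  assumes fin: "\<And>i. finite_measure (\<mu> i)" and sets: "\<And>i. sets (\<mu> i) = sets borel"
    and L: "prob_space L" "sets L = sets borel"
    and conv: "\<And>k (f :: 'b \<Rightarrow> real). k-lipschitz_on UNIV f \<Longrightarrow> bounded (range f) \<Longrightarrow>
      ((\<lambda>i. integral\<^sup>L (\<mu> i) f) \<longlongrightarrow> integral\<^sup>L L f) F"
  shows "weak_limit euclidean borel \<mu> L F"
proof -
  interpret L: prob_space L by fact
  have lower: "\<forall>\<^sub>F i in F. c < integral\<^sup>L (\<mu> i) f"
    if f: "continuous_on UNIV f" "bounded (range f)" and c: "c < integral\<^sup>L L f"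
        for f :: "'b \<Rightarrow> real" and c
  proof -
    obtain B where B: "\<And>x. \<bar>f x\<bar> \<le> B"
      using f(2) by (auto simp: bounded_iff)
    obtain g where g: "\<And>k::nat. (real k)-lipschitz_on UNIV (g k)" "\<And>k x. g k x \<le> f x"
      "\<And>k x. \<bar>g k x\<bar> \<le> B" "\<And>x. (\<lambda>k. g k x) \<longlonglongrightarrow> f x"
      using lipschitz_minorants[OF f(1) B] by blast
    have gc: "continuous_on UNIV (g k)" for k
      by (rule lipschitz_on_continuous_on[OF g(1)])
    have gb: "bounded (range (g k))" for k
      using g(3) by (auto simp: bounded_iff)
    have "(\<lambda>k. integral\<^sup>L L (g k)) \<longlonglongrightarrow> integral\<^sup>L L f"
      using f(1) gc g(3,4) L(2)
      by (intro integral_dominated_convergence[where w="\<lambda>_. B"])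
         (auto cong: measurable_cong_sets intro!: borel_measurable_continuous_onI)
    from order_tendstoD(1)[OF this c] obtain k where k: "c < integral\<^sup>L L (g k)"
      by (auto simp: eventually_sequentially)
    from order_tendstoD(1)[OF conv[OF g(1) gb] k] show ?thesis
    proof eventually_elim
      case (elim i)
      have "integral\<^sup>L (\<mu> i) (g k) \<le> integral\<^sup>L (\<mu> i) f"
        by (intro integral_mono continuous_bounded_integrable fin sets f gc gb g(2))
      then show ?case using elim by simp
    qed
  qed
  have "((\<lambda>i. integral\<^sup>L (\<mu> i) f) \<longlongrightarrow> integral\<^sup>L L f) F"
    if f: "continuous_on UNIV f" "bounded (range f)" for f :: "'b \<Rightarrow> real"
  proof (rule order_tendstoI)
    show "\<forall>\<^sub>F i in F. c < integral\<^sup>L (\<mu> i) f" if "c < integral\<^sup>L L f" for c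
      using lower[OF f that] .
    have f': "continuous_on UNIV (\<lambda>x. - f x)" "bounded (range (\<lambda>x. - f x))"
      using f by (auto intro: continuous_intros simp: bounded_iff)
    show "\<forall>\<^sub>F i in F. integral\<^sup>L (\<mu> i) f < c" if "c > integral\<^sup>L L f" for c
      using lower[OF f', of "-c"] that by simp
  qed
  then show ?thesis
    using L by (simp add: weak_limit_def)
qed

section \<open>Comparison and balance of finite measures\<close>

text \<open>Indicators of closed sets are limits of nonnegative continuous functions, which settles
  closed sets; inner regularity by compact sets, available on a Polish space, carries the inequality
  to all Borel sets.\<close>

lemma emeasure_le_if_integral_le:
  fixes A B :: "'b::polish_space measure"
  assumes A: "finite_measure A" "sets A = sets borel" and B: "finite_measure B" "sets B = sets borel"
    and le: "\<And>f :: 'b \<Rightarrow> real. continuous_on UNIV f \<Longrightarrow> bounded (range f) \<Longrightarrow> (\<And>x. 0 \<le> f x) \<Longrightarrow>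
      integral\<^sup>L B f \<le> integral\<^sup>L A f"
    and S: "S \<in> sets borel"
  shows "emeasure B S \<le> emeasure A S"
proof -
  interpret A: finite_measure A by fact
  interpret B: finite_measure B by fact
  have sp: "space A = UNIV" "space B = UNIV"
    using A(2) B(2) by (simp_all add: sets_eq_imp_space_eq[of _ borel])
  have closed: "emeasure B K \<le> emeasure A K" if K: "closed K" for K
  proof (cases "K = {}")
    case False
    \<comment> \<open>These functions decrease to the indicator of \<open>K\<close>. The empty set
      is treated apart because \<open>infdist\<close> to it is zero by convention.\<close>
    define f where "f k x = max 0 (1 - real k * infdist x K)" for k :: nat and x
    have f: "continuous_on UNIV (f k)" "\<And>x. 0 \<le> f k x" "\<And>x. \<bar>f k x\<bar> \<le> 1" for k
      by (auto simp: f_def infdist_nonneg intro!: continuous_intros)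
    then have fb: "bounded (range (f k))" for k
      by (intro boundedI[of _ 1]) auto
    have lim: "(\<lambda>k. f k x) \<longlonglongrightarrow> indicat_real K x" for x
    proof (cases "x \<in> K")
      case True
      then show ?thesis by (simp add: f_def)
    next
      case nK: False
      then have d: "infdist x K > 0"
        using K False in_closed_iff_infdist_zero[OF K False, of x] infdist_nonneg[of x K] by simp
      have "\<forall>\<^sub>F k in sequentially. real k \<ge> 1 / infdist x K"
        by real_asymp
      then have "\<forall>\<^sub>F k in sequentially. f k x = indicat_real K x"
        by eventually_elim (use nK d in \<open>auto simp: f_def field_simps\<close>)
      then show ?thesis
        by (rule tendsto_eventually)
    qed
    have *: "(\<lambda>k. integral\<^sup>L N (f k)) \<longlonglongrightarrow> measure N K"
      if N: "finite_measure N" "sets N = sets borel" for N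
    proof -
      interpret N: finite_measure N by fact
      have "(\<lambda>k. integral\<^sup>L N (f k)) \<longlonglongrightarrow> integral\<^sup>L N (indicat_real K)"
        using f(1,3) lim K N(2)
        by (intro integral_dominated_convergence[where w="\<lambda>_. 1"])
           (auto cong: measurable_cong_sets intro!: borel_measurable_continuous_onI)
      then show ?thesis
        using K N(2) by simp
    qed
    have "measure B K \<le> measure A K"
      by (rule LIMSEQ_le[OF *[OF B] *[OF A]]) (use le f fb in blast)
    then show ?thesis
      by (simp add: A.emeasure_eq_measure B.emeasure_eq_measure)
  qed simp
  have "emeasure B S = (SUP K\<in>{K. K \<subseteq> S \<and> compact K}. emeasure B K)"
    by (rule inner_regular[OF B(2)]) (use S sp in auto)
  also have "\<dots> \<le> (SUP K\<in>{K. K \<subseteq> S \<and> compact K}. emeasure A K)"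
    by (intro SUP_mono) (auto intro: closed compact_imp_closed)
  also have "\<dots> = emeasure A S"
    by (rule inner_regular[OF A(2), symmetric]) (use S sp in auto)
  finally show ?thesis .
qed

lemma measure_eqI_integral:
  fixes A B :: "'b::polish_space measure"
  assumes A: "finite_measure A" "sets A = sets borel" and B: "finite_measure B" "sets B = sets borel"
    and eq: "\<And>f :: 'b \<Rightarrow> real. continuous_on UNIV f \<Longrightarrow> bounded (range f) \<Longrightarrow>
      integral\<^sup>L A f = integral\<^sup>L B f"
  shows "A = B"
proof (rule measure_eqI)
  show "sets A = sets B" using A B by simp
  fix S assume "S \<in> sets A"
  then have S: "S \<in> sets borel" using A(2) by simp
  show "emeasure A S = emeasure B S"
    by (rule antisym; rule emeasure_le_if_integral_le) (use A B S eq in auto)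
qed

text \<open>The relation \<open>L = A + (C - B)\<close> is kept in the additive form
  \<open>L + B = A + C\<close>, since subtraction in \<open>ennreal\<close> is truncated. In this
  form it passes to sums and to increasing limits of integrands.\<close>

lemma nn_integral_balance:
  assumes sets: "sets A = sets N" "sets B = sets N" "sets C = sets N" "sets D = sets N"
    and eq: "\<And>S. S \<in> sets N \<Longrightarrow> emeasure A S + emeasure B S = emeasure C S + emeasure D S"
    and f: "f \<in> borel_measurable N"
  shows "integral\<^sup>N A f + integral\<^sup>N B f = integral\<^sup>N C f + integral\<^sup>N D f"
proof -
  have sp: "space A = space N" "space B = space N" "space C = space N" "space D = space N"
    using sets by (auto dest: sets_eq_imp_space_eq)
  have m: "g \<in> borel_measurable A" "g \<in> borel_measurable B" "g \<in> borel_measurable C"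
    "g \<in> borel_measurable D" if "g \<in> borel_measurable N" for g :: "'a \<Rightarrow> ennreal"
    using that sets by (simp_all cong: measurable_cong_sets)
  show ?thesis
    using f
  proof (induction rule: borel_measurable_induct)
    case (cong f g)
    have "integral\<^sup>N L f = integral\<^sup>N L g" if "space L = space N" for L
      using cong(3) that by (intro nn_integral_cong) simp
    then show ?case
      using cong(4) by (simp add: sp)
  next
    case (set S)
    then show ?case using eq sets by simp
  next
    case (mult u c)
    then show ?case
      by (simp add: nn_integral_cmult m flip: distrib_left)
  next
    case (add u v)
    then show ?case
      by (simp add: nn_integral_add m) (metis (no_types, lifting) add.assoc add.left_commute)
  next
    case (seq U)
    have S: "integral\<^sup>N L (\<lambda>x. SUP i. U i x) = (SUP i. integral\<^sup>N L (U i))" if "sets L = sets N" for L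
      using seq that by (intro nn_integral_monotone_convergence_SUP)
          (simp_all cong: measurable_cong_sets)
    have inc: "incseq (\<lambda>i. integral\<^sup>N L (U i))" for L
      using seq by (auto simp: incseq_def le_fun_def intro!: nn_integral_mono)
    have "integral\<^sup>N A (\<lambda>x. SUP i. U i x) + integral\<^sup>N B (\<lambda>x. SUP i. U i x)
      = (SUP i. integral\<^sup>N A (U i) + integral\<^sup>N B (U i))"
      using sets by (simp add: S ennreal_SUP_add inc)
    also have "\<dots> = (SUP i. integral\<^sup>N C (U i) + integral\<^sup>N D (U i))"
      using seq by simp
    also have "\<dots> = integral\<^sup>N C (\<lambda>x. SUP i. U i x) + integral\<^sup>N D (\<lambda>x. SUP i. U i x)"
      using sets by (simp add: S ennreal_SUP_add inc)
    finally show ?case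
      by (simp add: SUP_apply[abs_def] image_image cong: nn_integral_cong)
  qed
qed

lemma integral_balance:
  fixes f :: "'a \<Rightarrow> real"
  assumes fin: "finite_measure A" "finite_measure B" "finite_measure C" "finite_measure D"
    and sets: "sets A = sets N" "sets B = sets N" "sets C = sets N" "sets D = sets N"
    and eq: "\<And>S. S \<in> sets N \<Longrightarrow> emeasure A S + emeasure B S = emeasure C S + emeasure D S"
    and f: "f \<in> borel_measurable N" "bounded (range f)"
  shows "integral\<^sup>L A f + integral\<^sup>L B f = integral\<^sup>L C f + integral\<^sup>L D f"
proof -
  obtain K where K: "\<And>x. \<bar>f x\<bar> \<le> K"
    using f(2) by (auto simp: bounded_iff)
  have nonneg: "integral\<^sup>L A g + integral\<^sup>L B g = integral\<^sup>L C g + integral\<^sup>L D g"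
    if g: "g \<in> borel_measurable N" "bounded (range g)" "\<And>x. 0 \<le> g x" for g :: "'a \<Rightarrow> real"
  proof -
    have *: "integral\<^sup>N L (\<lambda>x. ennreal (g x)) = ennreal (integral\<^sup>L L g)"
      if "finite_measure L" "sets L = sets N" for L
      using that g by (intro nn_integral_eq_integral bounded_borel_integrable)
        (auto cong: measurable_cong_sets)
    have "ennreal (integral\<^sup>L A g + integral\<^sup>L B g) = ennreal (integral\<^sup>L C g + integral\<^sup>L D g)"
      using nn_integral_balance[OF sets eq, of "\<lambda>x. ennreal (g x)"] g
      by (simp add: * fin sets)
    then show ?thesis
      using g(3) by (subst (asm) ennreal_inj) auto
  qed
  \<comment> \<open>Adding \<open>K\<close> makes the function nonnegative. The added constants
    contribute equally to both sides, because the total masses balance as well.\<close>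
  have b: "bounded (range (\<lambda>x. f x + K))"
    using f(2) by (intro bounded_plus_comp) auto
  have int: "integrable L f" "integral\<^sup>L L (\<lambda>x. f x + K) = integral\<^sup>L L f + integral\<^sup>L L (\<lambda>_. K)"
    if "finite_measure L" "sets L = sets N" for L
  proof -
    show 1: "integrable L f"
      using that f by (intro bounded_borel_integrable) (auto cong: measurable_cong_sets)
    interpret finite_measure L by fact
    show "integral\<^sup>L L (\<lambda>x. f x + K) = integral\<^sup>L L f + integral\<^sup>L L (\<lambda>_. K)"
      using 1 by (subst Bochner_Integration.integral_add) auto
  qed
  have "K \<ge> 0" using K[of undefined] by auto
  then have "integral\<^sup>L A (\<lambda>x. f x + K) + integral\<^sup>L B (\<lambda>x. f x + K)
      = integral\<^sup>L C (\<lambda>x. f x + K) + integral\<^sup>L D (\<lambda>x. f x + K)"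
  proof (intro nonneg b)
    show "(\<lambda>x. f x + K) \<in> borel_measurable N"
      using f(1) by measurable
    show "0 \<le> f x + K" for x
      using K[of x] by linarith
  qed
  moreover have "integral\<^sup>L A (\<lambda>_. K) + integral\<^sup>L B (\<lambda>_. K)
      = integral\<^sup>L C (\<lambda>_. K) + integral\<^sup>L D (\<lambda>_. K)"
    by (rule nonneg) (use \<open>K \<ge> 0\<close> in auto)
  ultimately show ?thesis
    by (simp add: int fin sets)
qed

text \<open>The measure is \<open>A + (C - B)\<close>, where domination of \<open>B\<close> by
  \<open>C\<close> makes the difference a measure. It will be used with \<open>B\<close> the image
  of \<open>A\<close> under \<open>z\<close> and \<open>C\<close> the limit law of the shorter
  window.\<close>

lemma balanced_measure_exists:
  assumes fin: "finite_measure A" "finite_measure B" "finite_measure C"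
    and sets: "sets A = sets N" "sets B = sets N" "sets C = sets N"
    and le: "\<And>S. S \<in> sets N \<Longrightarrow> emeasure B S \<le> emeasure C S"
  obtains L where "sets L = sets N"
    "\<And>S. S \<in> sets N \<Longrightarrow> emeasure L S + emeasure B S = emeasure A S + emeasure C S"
proof -
  interpret A: finite_measure A by fact
  interpret B: finite_measure B by fact
  interpret C: finite_measure C by fact
  define D where "D = diff_measure C B"
  have D: "emeasure D S = emeasure C S - emeasure B S" if "S \<in> sets N" for S
    unfolding D_def using that le sets fin by (intro emeasure_diff_measure) auto
  have Ds: "sets D = sets N" "space D = space N"
    using sets by (auto simp: D_def dest: sets_eq_imp_space_eq)
  define L where "L = measure_of (space N) (sets N) (\<lambda>S. emeasure A S + emeasure D S)"
  have L: "emeasure L S = emeasure A S + emeasure D S" if "S \<in> sets N" for S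
    unfolding L_def
  proof (rule emeasure_measure_of_sigma)
    show "sigma_algebra (space N) (sets N)" ..
    show "positive (sets N) (\<lambda>S. emeasure A S + emeasure D S)"
      by (simp add: positive_def)
    show "countably_additive (sets N) (\<lambda>S. emeasure A S + emeasure D S)"
      using sets Ds by (intro countably_additiveI) (simp add: suminf_emeasure flip: suminf_add)
  qed fact
  show ?thesis
  proof (rule that[of L])
    show "sets L = sets N" by (simp add: L_def)
    fix S assume S: "S \<in> sets N"
    have "emeasure C S - emeasure B S + emeasure B S = emeasure C S"
      using le[OF S] by (simp add: diff_add_cancel_ennreal)
    then show "emeasure L S + emeasure B S = emeasure A S + emeasure C S"
      using S by (simp add: L D add.assoc)
  qed
qed

text \<open>The limit is \<open>A + (L' - z\<^sub>* A)\<close>. That \<open>z\<^sub>* A \<le> L'\<close> is seen on nonnegative continuous functions,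
  since the laws restricted to \<open>\<bar>s\<bar> > \<eta>\<close> are dominated by the unrestricted ones.\<close>

lemma weak_limit_truncation_step:
  fixes \<mu> :: "'i \<Rightarrow> 'b::polish_space measure" and s :: "'b \<Rightarrow> real" and z :: "'b \<Rightarrow> 'b"
  assumes \<mu>: "\<And>i. prob_space (\<mu> i)" "\<And>i. sets (\<mu> i) = sets borel"
    and A: "finite_measure A" "sets A = sets borel" and s: "s \<in> borel_measurable borel"
    and nz: "AE y in A. s y \<noteq> 0"
    and z: "continuous_on UNIV z" and zs: "\<And>y. dist y (z y) \<le> \<bar>s y\<bar>"
    and F: "F \<noteq> bot"
    and convA: "\<And>\<eta> (f :: 'b \<Rightarrow> real). \<eta> > 0 \<Longrightarrow> continuous_on UNIV f \<Longrightarrow> bounded (range f) \<Longrightarrow>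
      ((\<lambda>i. \<integral>y. indicat_real {y. \<eta> < \<bar>s y\<bar>} y * f y \<partial>\<mu> i)
          \<longlongrightarrow> (\<integral>y. indicat_real {y. \<eta> < \<bar>s y\<bar>} y * f y \<partial>A)) F"
    and convz: "weak_limit euclidean borel (\<lambda>i. distr (\<mu> i) borel z) L' F"
  shows "\<exists>L. weak_limit euclidean borel \<mu> L F"
proof -
  interpret A: finite_measure A by fact
  have L': "prob_space L'" "sets L' = sets borel"
    using convz by (auto simp: weak_limit_def)
  interpret L': prob_space L' by (rule L')
  have [measurable]: "z \<in> borel_measurable borel"
    using z by (rule borel_measurable_continuous_onI)
  note [measurable] = s
  note [measurable_cong] = A(2) L'(2) \<mu>(2)
  define B where "B = distr A borel z"
  have B: "finite_measure B" "sets B = sets borel"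
    unfolding B_def by (simp_all add: A.finite_measure_distr)
  have intB: "integral\<^sup>L B f = (\<integral>y. f (z y) \<partial>A)" if "continuous_on UNIV f" for f :: "'b \<Rightarrow> real"
    unfolding B_def using that
        by (intro integral_distr) (auto intro!: borel_measurable_continuous_onI)
  have cz: "continuous_on UNIV (\<lambda>y. f (z y))" "bounded (range (\<lambda>y. f (z y)))"
    if "continuous_on UNIV f" "bounded (range f)" for f :: "'b \<Rightarrow> real"
    using that continuous_on_compose2[OF that(1) z] by (auto simp: bounded_iff)
  have limz: "((\<lambda>i. \<integral>y. f (z y) \<partial>\<mu> i) \<longlongrightarrow> integral\<^sup>L L' f) F"
    if f: "continuous_on UNIV f" "bounded (range f)" for f :: "'b \<Rightarrow> real"
  proof -
    have "integral\<^sup>L (distr (\<mu> i) borel z) f = (\<integral>y. f (z y) \<partial>\<mu> i)" for i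
      using f by (intro integral_distr) (auto intro!: borel_measurable_continuous_onI)
    moreover have "((\<lambda>i. integral\<^sup>L (distr (\<mu> i) borel z) f) \<longlongrightarrow> integral\<^sup>L L' f) F"
      using convz f unfolding weak_limit_def by simp
    ultimately show ?thesis
      by simp
  qed
  have fin: "finite_measure (\<mu> i)" for i
    using \<mu>(1) by (simp add: prob_space.finite_measure)
  have int: "integrable N f" "integrable N (\<lambda>y. indicat_real {y. \<eta> < \<bar>s y\<bar>} y * f y)"
    if N: "finite_measure N" "sets N = sets borel" and f: "continuous_on UNIV f" "bounded (range f)"
    for N \<eta> and f :: "'b \<Rightarrow> real"
  proof -
    note [measurable_cong] = N(2)
    have [measurable]: "f \<in> borel_measurable borel"
      using f by (intro borel_measurable_continuous_onI)
    show "integrable N f"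
      using continuous_bounded_integrable[OF N f] .
    obtain K where K: "\<And>x. \<bar>f x\<bar> \<le> K"
      using f(2) by (auto simp: bounded_iff)
    moreover have "K \<ge> 0" using K[of undefined] by linarith
    ultimately have "bounded (range (\<lambda>y. indicat_real {y. \<eta> < \<bar>s y\<bar>} y * f y))"
      by (intro boundedI[of _ K]) (auto simp: indicator_def)
    then show "integrable N (\<lambda>y. indicat_real {y. \<eta> < \<bar>s y\<bar>} y * f y)"
      using N by (intro bounded_borel_integrable) measurable
  qed
  have le: "emeasure B S \<le> emeasure L' S" if "S \<in> sets borel" for S
  proof (rule emeasure_le_if_integral_le[OF L'.finite_measure_axioms L'(2) B _ that])
    fix f :: "'b \<Rightarrow> real" assume f: "continuous_on UNIV f" "bounded (range f)" "\<And>x. 0 \<le> f x"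
    obtain K where K: "\<And>x. \<bar>f x\<bar> \<le> K"
      using f(2) by (auto simp: bounded_iff)
    have [measurable]: "f \<in> borel_measurable borel"
      using f by (intro borel_measurable_continuous_onI)
    \<comment> \<open>As \<open>s\<close> vanishes almost nowhere under \<open>A\<close>, the
      truncations at \<open>\<eta> k\<close> exhaust \<open>A\<close>, and the inequality between
      truncated integrals survives the passage to the limit.\<close>
    define \<eta> where "\<eta> k = inverse (real (Suc k))" for k
    have \<eta>: "\<eta> k > 0" for k by (simp add: \<eta>_def)
    have "(\<lambda>k. \<integral>y. indicat_real {y. \<eta> k < \<bar>s y\<bar>} y * f (z y) \<partial>A) \<longlonglongrightarrow> (\<integral>y. f (z y) \<partial>A)"
    proof (rule integral_dominated_convergence[where w="\<lambda>_. K"])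
      show "AE y in A. (\<lambda>k. indicat_real {y. \<eta> k < \<bar>s y\<bar>} y * f (z y)) \<longlonglongrightarrow> f (z y)"
        using nz
      proof eventually_elim
        case (elim y)
        have "\<eta> \<longlonglongrightarrow> 0" unfolding \<eta>_def by (rule LIMSEQ_inverse_real_of_nat)
        then have "\<forall>\<^sub>F k in sequentially. \<eta> k < \<bar>s y\<bar>"
          using elim by (intro order_tendstoD(2)[of \<eta> 0]) auto
        then have "\<forall>\<^sub>F k in sequentially. indicat_real {y. \<eta> k < \<bar>s y\<bar>} y * f (z y) = f (z y)"
          by eventually_elim simp
        then show ?case by (rule tendsto_eventually)
      qed
      show "AE y in A. norm (indicat_real {y. \<eta> k < \<bar>s y\<bar>} y * f (z y)) \<le> K" for k
        using K K[THEN order_trans[OF abs_ge_zero]] by (auto simp: indicator_def)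
    qed (use K in auto)
    moreover have "(\<integral>y. indicat_real {y. \<eta> k < \<bar>s y\<bar>} y * f (z y) \<partial>A) \<le> integral\<^sup>L L' f" for k
    proof (rule tendsto_le[OF F limz[OF f(1,2)] convA[OF \<eta> cz[OF f(1,2)]]])
      show "\<forall>\<^sub>F i in F. (\<integral>y. indicat_real {y. \<eta> k < \<bar>s y\<bar>} y * f (z y) \<partial>\<mu> i) \<le> (\<integral>y. f (z y) \<partial>\<mu> i)"
        using f(3) by (intro always_eventually allI integral_mono int fin \<mu> cz f(1,2))
          (auto simp: indicator_def)
    qed
    ultimately show "integral\<^sup>L B f \<le> integral\<^sup>L L' f"
      unfolding intB[OF f(1)] by (intro LIMSEQ_le_const2) auto
  qed
  obtain L where L: "sets L = sets borel"
    and bal: "\<And>S. S \<in> sets borel \<Longrightarrow> emeasure L S + emeasure B S = emeasure A S + emeasure L' S"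
    using balanced_measure_exists[OF A(1) B(1) L'.finite_measure_axioms A(2) B(2) L'(2) le] by blast
  have sp: "space L = UNIV" "space A = UNIV" "space L' = UNIV" "space B = UNIV"
    using L A L' B by (simp_all add: sets_eq_imp_space_eq[of _ borel])
  have BA: "emeasure B UNIV = emeasure A UNIV"
    using sp by (simp add: B_def emeasure_distr)
  \<comment> \<open>Taking images under \<open>z\<close> preserves total mass, so the finite masses
    of \<open>A\<close> and \<open>B\<close> cancel and \<open>L\<close> inherits mass one from
    \<open>L'\<close>.\<close>
  have "emeasure A UNIV + emeasure L UNIV = emeasure A UNIV + 1"
    using bal[of UNIV] L'.emeasure_space_1 sp BA by (simp add: add.commute)
  then have "emeasure L UNIV = 1"
    using A.emeasure_finite[of UNIV] by (simp add: ennreal_add_left_cancel)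
  then have Lp: "prob_space L"
    using sp by (intro prob_spaceI) simp
  then interpret L: prob_space L .
  have "measure A UNIV \<le> 1"
    using le[of UNIV] L'.emeasure_space_1 sp BA A.emeasure_eq_measure by simp
  have "weak_limit euclidean borel \<mu> L F"
  proof (rule weak_limit_if_lipschitz[OF fin \<mu>(2) Lp L])
    fix K and f :: "'b \<Rightarrow> real" assume lip: "K-lipschitz_on UNIV f" and fb: "bounded (range f)"
    have K: "K \<ge> 0" using lip by (rule lipschitz_on_nonneg)
    have f: "continuous_on UNIV f" using lip by (rule lipschitz_on_continuous_on)
    note cz = cz[OF f fb]
    \<comment> \<open>The combination equals f where |s| > \<eta> and f o z elsewhere; there the
      Lipschitz bound applies to a displacement of at most \<eta>. The estimate is used twice: for
      \<mu> i it bounds the error of the approximation, for \<open>A\<close> it bounds the distance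
      between the limit of the approximations and the integral against \<open>L\<close>.\<close>
    have small: "\<bar>integral\<^sup>L N f - ((\<integral>y. indicat_real {y. \<eta> < \<bar>s y\<bar>} y * f y \<partial>N) + (\<integral>y. f (z y) \<partial>N)
        - (\<integral>y. indicat_real {y. \<eta> < \<bar>s y\<bar>} y * f (z y) \<partial>N))\<bar> \<le> K * \<eta>" (is "\<bar>?d\<bar> \<le> _")
      if N: "finite_measure N" "sets N = sets borel" "measure N UNIV \<le> 1" and \<eta>: "\<eta> > 0" for N \<eta>
    proof -
      interpret N: finite_measure N by fact
      have "?d = (\<integral>y. (f y - (indicat_real {y. \<eta> < \<bar>s y\<bar>} y * f y + f (z y)
        - indicat_real {y. \<eta> < \<bar>s y\<bar>} y * f (z y))) \<partial>N)"
        using int[OF N(1,2) f fb] int[OF N(1,2) cz] by simp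
      also have "\<bar>\<dots>\<bar> \<le> (\<integral>y. K * \<eta> \<partial>N)"
      proof (rule abs_integral_le)
        fix y
        have "\<bar>f y - f (z y)\<bar> \<le> K * dist y (z y)"
          using lipschitz_onD[OF lip, of y "z y"] by (simp add: dist_real_def)
        also have "\<dots> \<le> K * \<bar>s y\<bar>"
          using zs K by (intro mult_left_mono) auto
        also have "\<dots> \<le> K * \<eta>" if "\<not> \<eta> < \<bar>s y\<bar>"
          using that K by (intro mult_left_mono) auto
        finally show "\<bar>f y - (indicat_real {y. \<eta> < \<bar>s y\<bar>} y * f y + f (z y)
          - indicat_real {y. \<eta> < \<bar>s y\<bar>} y * f (z y))\<bar> \<le> K * \<eta>"
          using K \<eta> by (auto simp: indicator_def)
      qed (use int[OF N(1,2) f fb] int[OF N(1,2) cz] in auto)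
      also have "\<dots> = measure N UNIV * (K * \<eta>)"
        using N(2) by (simp add: sets_eq_imp_space_eq[of N borel])
      also have "\<dots> \<le> 1 * (K * \<eta>)"
        using N(3) K \<eta> by (intro mult_right_mono) auto
      finally show ?thesis by simp
    qed
    have balf: "integral\<^sup>L L f = integral\<^sup>L A f + integral\<^sup>L L' f - (\<integral>y. f (z y) \<partial>A)"
      using integral_balance[OF L.finite_measure_axioms B(1) A(1) L'.finite_measure_axioms L B(2) A(2) L'(2) bal
        borel_measurable_continuous_onI[OF f] fb] intB[OF f] by simp
    show "((\<lambda>i. integral\<^sup>L (\<mu> i) f) \<longlongrightarrow> integral\<^sup>L L f) F"
    proof (rule tendsto_of_approximations)
      fix e :: real assume e: "e > 0"
      \<comment> \<open>The \<open>+ 1\<close> keeps the denominator positive when the Lipschitz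
        constant is zero.\<close>
      define \<eta> where "\<eta> = e / (K + 1)"
      have \<eta>: "\<eta> > 0" and Ke: "K * \<eta> \<le> e"
        using e K by (auto simp: \<eta>_def field_simps)
      show "\<exists>g l'. (g \<longlongrightarrow> l') F \<and> (\<forall>\<^sub>F i in F. \<bar>integral\<^sup>L (\<mu> i) f - g i\<bar> \<le> e)
          \<and> \<bar>l' - integral\<^sup>L L f\<bar> \<le> e"
      proof (intro exI conjI)
        show "((\<lambda>i. (\<integral>y. indicat_real {y. \<eta> < \<bar>s y\<bar>} y * f y \<partial>\<mu> i) + (\<integral>y. f (z y) \<partial>\<mu> i)
            - (\<integral>y. indicat_real {y. \<eta> < \<bar>s y\<bar>} y * f (z y) \<partial>\<mu> i)) \<longlongrightarrow>
          (\<integral>y. indicat_real {y. \<eta> < \<bar>s y\<bar>} y * f y \<partial>A) + integral\<^sup>L L' f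
            - (\<integral>y. indicat_real {y. \<eta> < \<bar>s y\<bar>} y * f (z y) \<partial>A)) F"
          by (intro tendsto_intros convA limz \<eta> f fb cz)
        have m1: "measure (\<mu> i) UNIV \<le> 1" for i
          using \<mu> by (simp add: prob_space.prob_le_1)
        show "\<forall>\<^sub>F i in F. \<bar>integral\<^sup>L (\<mu> i) f - ((\<integral>y. indicat_real {y. \<eta> < \<bar>s y\<bar>} y * f y \<partial>\<mu> i)
            + (\<integral>y. f (z y) \<partial>\<mu> i) - (\<integral>y. indicat_real {y. \<eta> < \<bar>s y\<bar>} y * f (z y) \<partial>\<mu> i))\<bar> \<le> e"
          using order_trans[OF small[OF fin \<mu>(2) m1 \<eta>] Ke] by auto
        show "\<bar>(\<integral>y. indicat_real {y. \<eta> < \<bar>s y\<bar>} y * f y \<partial>A) + integral\<^sup>L L' f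
            - (\<integral>y. indicat_real {y. \<eta> < \<bar>s y\<bar>} y * f (z y) \<partial>A) - integral\<^sup>L L f\<bar> \<le> e"
          using order_trans[OF small[OF A \<open>measure A UNIV \<le> 1\<close> \<eta>] Ke] unfolding balf
          by linarith
      qed
    qed
  qed
  then show ?thesis by blast
qed

text \<open>No mass can hide on |s| \<le> \<eta>: the test function one shows that the mass of \<mu>
  i above a small \<eta> is eventually larger than 1 - d, because \<open>A\<close> has total mass
  one and does not charge s = 0. Truncated integrals therefore approximate the full ones uniformly
  in i.\<close>

lemma weak_limit_if_limits_above:
  fixes \<mu> :: "'i \<Rightarrow> 'b::topological_space measure" and s :: "'b \<Rightarrow> real"
  assumes \<mu>: "\<And>i. prob_space (\<mu> i)" "\<And>i. sets (\<mu> i) = sets borel"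
    and A: "prob_space A" "sets A = sets borel" and s [measurable]: "s \<in> borel_measurable borel"
    and nz: "AE y in A. s y \<noteq> 0"
    and convA: "\<And>\<eta> (f :: 'b \<Rightarrow> real). \<eta> > 0 \<Longrightarrow> continuous_on UNIV f \<Longrightarrow> bounded (range f) \<Longrightarrow>
      ((\<lambda>i. \<integral>y. indicat_real {y. \<eta> < \<bar>s y\<bar>} y * f y \<partial>\<mu> i)
          \<longlongrightarrow> (\<integral>y. indicat_real {y. \<eta> < \<bar>s y\<bar>} y * f y \<partial>A)) F"
  shows "weak_limit euclidean borel \<mu> A F"
proof -
  interpret A: prob_space A by fact
  note [measurable_cong] = A(2) \<mu>(2)
  define \<eta> where "\<eta> k = inverse (real (Suc k))" for k
  have \<eta>: "\<eta> k > 0" for k by (simp add: \<eta>_def)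
  have "(\<lambda>k. \<integral>y. indicat_real {y. \<eta> k < \<bar>s y\<bar>} y \<partial>A) \<longlonglongrightarrow> (\<integral>y. 1 \<partial>A)"
  proof (rule integral_dominated_convergence[where w="\<lambda>_. 1"])
    show "AE y in A. (\<lambda>k. indicat_real {y. \<eta> k < \<bar>s y\<bar>} y) \<longlonglongrightarrow> 1"
      using nz
    proof eventually_elim
      case (elim y)
      have "\<eta> \<longlonglongrightarrow> 0" unfolding \<eta>_def by (rule LIMSEQ_inverse_real_of_nat)
      then have "\<forall>\<^sub>F k in sequentially. \<eta> k < \<bar>s y\<bar>"
        using elim by (intro order_tendstoD(2)[of \<eta> 0]) auto
      then have "\<forall>\<^sub>F k in sequentially. indicat_real {y. \<eta> k < \<bar>s y\<bar>} y = 1"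
        by eventually_elim simp
      then show ?case by (rule tendsto_eventually)
    qed
  qed auto
  then have lim1: "(\<lambda>k. \<integral>y. indicat_real {y. \<eta> k < \<bar>s y\<bar>} y \<partial>A) \<longlonglongrightarrow> 1"
    using A.prob_space by simp
  have "((\<lambda>i. integral\<^sup>L (\<mu> i) f) \<longlongrightarrow> integral\<^sup>L A f) F"
    if f: "continuous_on UNIV f" "bounded (range f)" for f :: "'b \<Rightarrow> real"
  proof (rule tendsto_of_approximations)
    fix e :: real assume e: "e > 0"
    have [measurable]: "f \<in> borel_measurable borel"
      using f by (intro borel_measurable_continuous_onI)
    obtain K where K: "\<And>y. \<bar>f y\<bar> \<le> K"
      using f(2) by (auto simp: bounded_iff)
    have K0: "K \<ge> 0" using K[of undefined] by linarith
    define d where "d = e / (K + 1)"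
    have d: "d > 0" "K * d \<le> e" using e K0 by (auto simp: d_def field_simps)
    have "1 - d < 1" using d by simp
    from order_tendstoD(1)[OF lim1 this]
    obtain k where k: "1 - d < (\<integral>y. indicat_real {y. \<eta> k < \<bar>s y\<bar>} y \<partial>A)"
      by (auto simp: eventually_sequentially)
    have small: "\<bar>integral\<^sup>L N f - (\<integral>y. indicat_real {y. \<eta> k < \<bar>s y\<bar>} y * f y \<partial>N)\<bar> \<le> e"
      if N: "prob_space N" "sets N
          = sets borel" and big: "1 - d < (\<integral>y. indicat_real {y. \<eta> k < \<bar>s y\<bar>} y \<partial>N)" for N
    proof -
      interpret N: prob_space N by fact
      note [measurable_cong] = N(2)
      have I: "integrable N f" "integrable N (\<lambda>y. indicat_real {y. \<eta> k < \<bar>s y\<bar>} y * f y)"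
        "integrable N (indicat_real {y. \<eta> k < \<bar>s y\<bar>})"
        using K K0 by (auto intro!: N.integrable_const_bound[where B="max K 1"] simp: indicator_def max.coboundedI1)
      have "integral\<^sup>L N f - (\<integral>y. indicat_real {y. \<eta> k < \<bar>s y\<bar>} y * f y \<partial>N)
          = (\<integral>y. f y - indicat_real {y. \<eta> k < \<bar>s y\<bar>} y * f y \<partial>N)"
        using I by simp
      also have "\<bar>\<dots>\<bar> \<le> (\<integral>y. K * (1 - indicat_real {y. \<eta> k < \<bar>s y\<bar>} y) \<partial>N)"
      proof (rule abs_integral_le)
        show "integrable N (\<lambda>y. K * (1 - indicat_real {y. \<eta> k < \<bar>s y\<bar>} y))"
          using I(3) by (intro integrable_mult_right Bochner_Integration.integrable_diff) auto
        show "\<bar>f y - indicat_real {y. \<eta> k < \<bar>s y\<bar>} y * f y\<bar>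
            \<le> K * (1 - indicat_real {y. \<eta> k < \<bar>s y\<bar>} y)" for y
          using K K0 by (auto simp: indicator_def)
      qed (use I in simp)
      also have "\<dots> = K * (1 - (\<integral>y. indicat_real {y. \<eta> k < \<bar>s y\<bar>} y \<partial>N))"
        using I N.prob_space by simp
      also have "\<dots> \<le> K * d" using big K0 by (intro mult_left_mono) auto
      finally show ?thesis using d by linarith
    qed
    show "\<exists>g l'. (g \<longlongrightarrow> l') F \<and> (\<forall>\<^sub>F i in F. \<bar>integral\<^sup>L (\<mu> i) f - g i\<bar> \<le> e) \<and> \<bar>l' - integral\<^sup>L A f\<bar>
        \<le> e"
    proof (intro exI conjI)
      show "((\<lambda>i. \<integral>y. indicat_real {y. \<eta> k < \<bar>s y\<bar>} y * f y \<partial>\<mu> i)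
          \<longlongrightarrow> (\<integral>y. indicat_real {y. \<eta> k < \<bar>s y\<bar>} y * f y \<partial>A)) F"
        by (rule convA[OF \<eta> f])
      show "\<bar>(\<integral>y. indicat_real {y. \<eta> k < \<bar>s y\<bar>} y * f y \<partial>A) - integral\<^sup>L A f\<bar> \<le> e"
        using small[OF A k] by linarith
      have "((\<lambda>i. \<integral>y. indicat_real {y. \<eta> k < \<bar>s y\<bar>} y \<partial>\<mu> i)
          \<longlongrightarrow> (\<integral>y. indicat_real {y. \<eta> k < \<bar>s y\<bar>} y \<partial>A)) F"
        using convA[OF \<eta>[of k], of "\<lambda>_. 1"] by simp
      from order_tendstoD(1)[OF this k]
      show "\<forall>\<^sub>F i in F. \<bar>integral\<^sup>L (\<mu> i) f - (\<integral>y. indicat_real {y. \<eta> k < \<bar>s y\<bar>} y * f y \<partial>\<mu> i)\<bar> \<le> e"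
        by eventually_elim (rule small[OF \<mu>])
    qed
  qed
  then show ?thesis
    using A by (simp add: weak_limit_def)
qed

section \<open>The sequence space \<open>int \<Rightarrow> real\<close> and its finite
  windows\<close>

text \<open>The metric sums coordinate distances, capped at one, with weights (1/2)^n. Since
  \<open>from_nat\<close> need not be injective, every summand is bounded by its weight times |y j|;
  the factor 2 is the sum of the weights.\<close>

lemma dist_fun_upd_le:
  fixes y :: "'k::countable \<Rightarrow> real"
  shows "dist y (y(j := 0)) \<le> 2 * \<bar>y j\<bar>"
proof -
  have bound: "(1/2)^n * min (dist (y (from_nat n)) ((y(j := 0)) (from_nat n))) 1
      \<le> (1/2)^n * \<bar>y j\<bar>" for n
    by (intro mult_left_mono) auto
  have s: "summable (\<lambda>n. (1/2)^n * \<bar>y j\<bar> :: real)"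
    by (intro summable_mult2 summable_geometric) simp
  have "dist y (y(j := 0)) \<le> (\<Sum>n. (1/2)^n * \<bar>y j\<bar>)"
    unfolding dist_fun_def
    by (intro suminf_le bound s summable_comparison_test'[OF s, of 0]) (use bound in auto)
  also have "\<dots> = 2 * \<bar>y j\<bar>"
    by (subst suminf_mult2[symmetric]) (auto simp: suminf_geometric summable_geometric)
  finally show ?thesis .
qed

lemma measurable_coordinate: "(\<lambda>y. y j) \<in> borel_measurable (borel ::
    ('k::countable \<Rightarrow> real) measure)"
  by (rule borel_measurable_continuous_onI) (rule continuous_on_product_then_coordinatewise, simp)

text \<open>Embeds windows that are \<open>undefined\<close> off \<open>I\<close> into the full
  sequence space, a type with a Polish topology, so that the results for type-class spaces apply.
  Restriction to \<open>I\<close> undoes it.\<close>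

definition zero_extend :: "int set \<Rightarrow> (int \<Rightarrow> real) \<Rightarrow> int \<Rightarrow> real" where
  "zero_extend I y = (\<lambda>t. if t \<in> I then y t else 0)"

lemma measurable_restrict_coordinates:
  "(\<lambda>y. restrict y I) \<in> measurable (borel :: (int \<Rightarrow> real) measure) (power_borel I)"
  by (intro measurable_restrict measurable_coordinate)

lemma measurable_zero_extend: "zero_extend I \<in> measurable (power_borel I) borel"
proof (rule measurable_coordinatewise_then_product)
  show "(\<lambda>y. zero_extend I y t) \<in> borel_measurable (power_borel I)" for t
    by (cases "t \<in> I") (auto simp: zero_extend_def)
qed

lemma restrict_zero_extend: "y \<in> space (power_borel I) \<Longrightarrow> restrict (zero_extend I y) I = y"
  by (auto simp: zero_extend_def space_PiM PiE_def extensional_def fun_eq_iff)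

lemma continuous_map_restrict_coordinates:
  fixes f :: "(int \<Rightarrow> real) \<Rightarrow> real"
  assumes "continuous_map (power_top I) euclideanreal f"
  shows "continuous_on UNIV (\<lambda>y. f (restrict y I))"
proof -
  have "continuous_map (product_topology (\<lambda>_. euclidean) UNIV) (power_top I) (\<lambda>y. restrict y I)"
    unfolding continuous_map_componentwise by (auto intro: continuous_map_product_projection)
  from continuous_map_compose[OF this assms]
  show ?thesis by (simp add: euclidean_product_topology o_def)
qed

lemma continuous_map_zero_extend:
  fixes g :: "(int \<Rightarrow> real) \<Rightarrow> real"
  assumes "continuous_on UNIV g"
  shows "continuous_map (power_top I) euclideanreal (\<lambda>y. g (zero_extend I y))"
proof -
  have "continuous_map (power_top I) (product_topology (\<lambda>_. euclidean) UNIV) (zero_extend I)"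
  proof (subst continuous_map_componentwise_UNIV, intro allI)
    show "continuous_map (power_top I) euclideanreal (\<lambda>y. zero_extend I y t)" for t
      by (cases "t \<in> I") (auto simp: zero_extend_def intro: continuous_map_product_projection)
  qed
  moreover have "continuous_map (product_topology (\<lambda>_. euclidean) UNIV) euclideanreal g"
    using assms by (simp add: euclidean_product_topology)
  ultimately show ?thesis
    using continuous_map_compose[of "power_top I" _ "zero_extend I" _ g] by (simp add: o_def)
qed

text \<open>On the windows, f factors through \<open>zero_extend I\<close> followed by a continuous
  function on the whole sequence space. The abstract product topology thus never has to be matched
  with the product sigma-algebra directly.\<close>

lemma measurable_continuous_map_power_top:
  fixes f :: "(int \<Rightarrow> real) \<Rightarrow> real"
  assumes "continuous_map (power_top I) euclideanreal f"
  shows "f \<in> borel_measurable (power_borel I)"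
proof -
  have "(\<lambda>y. f (restrict (zero_extend I y) I)) \<in> borel_measurable (power_borel I)"
    by (rule measurable_compose[OF measurable_zero_extend
      borel_measurable_continuous_onI[OF continuous_map_restrict_coordinates[OF assms]]])
  then show ?thesis
    by (rule measurable_cong[THEN iffD1, rotated]) (simp add: restrict_zero_extend)
qed

text \<open>Uniqueness is inherited from the sequence space: the images under
  \<open>zero_extend I\<close> have the same integrals of bounded continuous functions, hence
  coincide, and restriction recovers the two limits from them.\<close>

lemma weak_limit_power_unique:
  fixes \<mu> :: "'i \<Rightarrow> (int \<Rightarrow> real) measure"
  assumes "weak_limit (power_top I) (power_borel I) \<mu> \<nu> F" "weak_limit (power_top I)
      (power_borel I) \<mu> \<nu>' F"
    and F: "F \<noteq> bot"
  shows "\<nu> = \<nu>'"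
proof -
  have ps: "prob_space \<nu>" "sets \<nu> = sets (power_borel I)" "prob_space \<nu>'" "sets \<nu>'
      = sets (power_borel I)"
    using assms by (auto simp: weak_limit_def)
  have meas: "zero_extend I \<in> borel_measurable N" "(\<lambda>y. restrict y I) \<in> measurable borel N"
    if "sets N = sets (power_borel I)" for N
    using measurable_zero_extend measurable_restrict_coordinates that
        by (simp_all cong: measurable_cong_sets)
  have "distr \<nu> borel (zero_extend I) = distr \<nu>' borel (zero_extend I)"
  proof (rule measure_eqI_integral)
    fix g :: "(int \<Rightarrow> real) \<Rightarrow> real" assume g: "continuous_on UNIV g" "bounded (range g)"
    have "bounded ((\<lambda>y. g (zero_extend I y)) ` topspace (power_top I))"
      by (rule bounded_subset[OF g(2)]) auto
    with assms(1,2) continuous_map_zero_extend[OF g(1)]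
    have "((\<lambda>i. \<integral>y. g (zero_extend I y) \<partial>\<mu> i) \<longlongrightarrow> (\<integral>y. g (zero_extend I y) \<partial>\<nu>)) F"
      "((\<lambda>i. \<integral>y. g (zero_extend I y) \<partial>\<mu> i) \<longlongrightarrow> (\<integral>y. g (zero_extend I y) \<partial>\<nu>')) F"
      unfolding weak_limit_def by blast+
    then have "(\<integral>y. g (zero_extend I y) \<partial>\<nu>) = (\<integral>y. g (zero_extend I y) \<partial>\<nu>')"
      using F by (rule tendsto_unique[rotated])
    then show "integral\<^sup>L (distr \<nu> borel (zero_extend I)) g
        = integral\<^sup>L (distr \<nu>' borel (zero_extend I)) g"
      using meas ps g by (simp add: integral_distr borel_measurable_continuous_onI)
  qed (use meas ps in \<open>auto intro!: prob_space.finite_measure prob_space.prob_space_distr\<close>)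
  moreover have "distr (distr N borel (zero_extend I)) N (\<lambda>y. restrict y I) = N" if N: "sets N
      = sets (power_borel I)" for N
  proof -
    have "space N = space (power_borel I)" using N by (rule sets_eq_imp_space_eq)
    then have "distr N N ((\<lambda>y. restrict y I) \<circ> zero_extend I) = distr N N (\<lambda>y. y)"
      by (intro distr_cong) (simp_all add: restrict_zero_extend)
    then show ?thesis
      using meas[OF N] by (simp add: distr_distr)
  qed
  moreover have "distr N \<nu> r = distr N \<nu>' r" for N and r :: "(int \<Rightarrow> real) \<Rightarrow> _"
    using ps by (intro distr_cong) auto
  ultimately show ?thesis
    using ps by metis
qed

section \<open>Regularly varying tails\<close>

text \<open>Convergence along all curves \<open>W x \<rightarrow> w\<close> is convergence along the product filter: points at
  which the latter fails can be threaded into one curve.\<close>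

lemma filterlim_prod_if_curves:
  fixes h :: "real \<Rightarrow> 'b::metric_space \<Rightarrow> 'c::metric_space"
  assumes curve: "\<And>W. (W \<longlongrightarrow> w) at_top \<Longrightarrow> ((\<lambda>x. h x (W x)) \<longlongrightarrow> l) at_top"
  shows "((\<lambda>(x, v). h x v) \<longlongrightarrow> l) (at_top \<times>\<^sub>F nhds w)"
proof (rule ccontr)
  assume "\<not> ?thesis"
  then obtain e where e: "e > 0"
    and ne: "\<not> (\<forall>\<^sub>F p in at_top \<times>\<^sub>F nhds w. dist ((\<lambda>(x, v). h x v) p) l < e)"
    by (auto simp: tendsto_iff)
  have "\<exists>x v. x \<ge> real n \<and> dist v w < inverse (real (Suc n)) \<and> \<not> dist (h x v) l < e" for n
  proof (rule ccontr)
    assume contra: "\<nexists>x v. x \<ge> real n \<and> dist v w < inverse (real (Suc n)) \<and> \<not> dist (h x v) l < e"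
    have "\<forall>\<^sub>F x in at_top. x \<ge> real n"
      by (rule eventually_ge_at_top)
    moreover have "\<forall>\<^sub>F v in nhds w. dist v w < inverse (real (Suc n))"
      by (rule eventually_nhds_metric[THEN iffD2]) (auto intro!: exI[of _ "inverse (real (Suc n))"])
    ultimately have "\<forall>\<^sub>F p in at_top \<times>\<^sub>F nhds w. dist ((\<lambda>(x, v). h x v) p) l < e"
      unfolding eventually_prod_filter using contra by (metis case_prod_conv)
    then show False using ne by blast
  qed
  then obtain X V where XV: "\<And>n. X n \<ge> real n" "\<And>n. dist (V n) w < inverse (real (Suc n))"
    "\<And>n. \<not> dist (h (X n) (V n)) l < e"
    by metis
  \<comment> \<open>The curve \<open>W\<close> takes the bad value \<open>V n\<close> at time
    \<open>X n\<close> and rests at w otherwise. Several indices may share one time, so an index is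
    chosen for each.\<close>
  define N where "N x = (SOME n. X n = x)" for x
  define W where "W x = (if x \<in> range X then V (N x) else w)" for x
  have N: "X (N x) = x" if "x \<in> range X" for x
    using someI_ex[of "\<lambda>n. X n = x"] that unfolding N_def by auto
  have "(W \<longlongrightarrow> w) at_top"
  proof (rule tendstoI)
    fix d :: real assume "d > 0"
    then obtain n0 where n0: "inverse (real (Suc n0)) < d"
      using reals_Archimedean by blast
    have "\<forall>\<^sub>F x in at_top. x > Max (X ` {..n0})"
      by (rule eventually_gt_at_top)
    then show "\<forall>\<^sub>F x in at_top. dist (W x) w < d"
    proof eventually_elim
      case (elim x)
      show ?case
      proof (cases "x \<in> range X")
        case True
        \<comment> \<open>Beyond the largest of the first n0 + 1 times only later indices occur, and
          their values are within d of w.\<close>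
        have "\<not> N x \<le> n0"
        proof
          assume "N x \<le> n0"
          then have "X (N x) \<le> Max (X ` {..n0})" by (intro Max_ge) auto
          then show False using elim N[OF True] by simp
        qed
        then have le: "inverse (real (Suc (N x))) \<le> inverse (real (Suc n0))"
          by (intro le_imp_inverse_le) auto
        show ?thesis
          using True less_trans[OF less_le_trans[OF XV(2) le] n0] by (simp add: W_def)
      qed (use \<open>d > 0\<close> in \<open>simp add: W_def\<close>)
    qed
  qed
  from tendstoD[OF curve[OF this] e] have ev: "\<forall>\<^sub>F x in at_top. dist (h x (W x)) l < e" .
  have "filterlim X at_top sequentially"
    by (rule filterlim_at_top_mono[OF filterlim_real_sequentially]) (use XV(1) in auto)
  then have "\<forall>\<^sub>F n in sequentially. dist (h (X n) (W (X n))) l < e"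
    using ev by (auto simp: filterlim_iff)
  then obtain n where n: "dist (h (X n) (W (X n))) l < e"
    by (auto simp: eventually_sequentially)
  have "W (X n) = V (N (X n))" "X (N (X n)) = X n"
    using N[of "X n"] by (auto simp: W_def)
  then show False
    using n XV(3)[of "N (X n)"] by simp
qed

section \<open>The limiting tail measure\<close>

definition tail_density :: "real \<Rightarrow> real \<Rightarrow> real \<Rightarrow> real \<Rightarrow> real" where
  "tail_density \<alpha> a b w = (if w > 0 then a else b) * \<alpha> * \<bar>w\<bar> powr (- \<alpha> - 1)"

text \<open>The vague limit of the scaled and renormalised laws of a regularly varying variable. For
  positive \<alpha> and a + b it has infinite mass near the origin, so it is only met restricted to
  |w| > c with c > 0.\<close>

definition tail_measure :: "real \<Rightarrow> real \<Rightarrow> real \<Rightarrow> real measure" where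
  "tail_measure \<alpha> a b = density lborel (\<lambda>w. ennreal (tail_density \<alpha> a b w))"

lemma borel_measurable_tail_density [measurable]: "tail_density \<alpha> a b \<in> borel_measurable borel"
  unfolding tail_density_def by measurable

lemma sets_tail_measure [measurable_cong, simp]: "sets (tail_measure \<alpha> a b) = sets borel"
  by (simp add: tail_measure_def)

lemma space_tail_measure [simp]: "space (tail_measure \<alpha> a b) = UNIV"
  by (simp add: tail_measure_def)

lemma sigma_finite_tail_measure: "sigma_finite_measure (tail_measure \<alpha> a b)"
  unfolding tail_measure_def
      by (subst sigma_finite_measure.sigma_finite_iff_density_finite[OF sigma_finite_lborel]) auto

lemma AE_tail_measure: "AE w in lborel. P w \<Longrightarrow> AE w in tail_measure \<alpha> a b. P w"
  unfolding tail_measure_def by (subst AE_density) auto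

lemma tail_measure_Ioi:
  assumes "\<alpha> > 0" "a \<ge> 0" "c > 0"
  shows "emeasure (tail_measure \<alpha> a b) {c<..} = ennreal (a * c powr - \<alpha>)"
proof -
  have "emeasure (tail_measure \<alpha> a b) {c<..}
    = (\<integral>\<^sup>+w. ennreal (tail_density \<alpha> a b w) * indicator {c<..} w \<partial>lborel)"
    by (simp add: tail_measure_def emeasure_density)
  also have "\<dots> = (\<integral>\<^sup>+w. ennreal (a * \<alpha> * w powr (- \<alpha> - 1)) * indicator {c..} w \<partial>lborel)"
  proof (rule nn_integral_cong_AE)
    show "AE w in lborel. ennreal (tail_density \<alpha> a b w) * indicator {c<..} w
        = ennreal (a * \<alpha> * w powr (- \<alpha> - 1)) * indicator {c..} w"
      using AE_lborel_singleton[of c]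
      by eventually_elim (use \<open>c > 0\<close> in \<open>auto simp: tail_density_def indicator_def\<close>)
  qed
  also have "\<dots> = ennreal (0 - (- a * c powr - \<alpha>))"
  proof (rule nn_integral_FTC_atLeast)
    fix x assume "c \<le> x"
    then show "DERIV (\<lambda>w. - a * w powr - \<alpha>) x :> a * \<alpha> * x powr (- \<alpha> - 1)"
      using \<open>c > 0\<close> by (auto intro!: derivative_eq_intros simp: mult.assoc)
    show "0 \<le> a * \<alpha> * x powr (- \<alpha> - 1)" using assms by simp
  next
    have "((\<lambda>w. - a * w powr - \<alpha>) \<longlongrightarrow> - a * 0) at_top"
      using assms by (intro tendsto_intros tendsto_neg_powr filterlim_ident) auto
    then show "((\<lambda>w. - a * w powr - \<alpha>) \<longlongrightarrow> 0) at_top" by simp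
  qed simp
  finally show ?thesis by simp
qed

lemma tail_measure_Iio:
  assumes "\<alpha> > 0" "b \<ge> 0" "c > 0"
  shows "emeasure (tail_measure \<alpha> a b) {..<-c} = ennreal (b * c powr - \<alpha>)"
proof -
  have "emeasure (tail_measure \<alpha> a b) {..<-c}
    = (\<integral>\<^sup>+w. ennreal (tail_density \<alpha> a b w) * indicator {..<-c} w \<partial>lborel)"
    by (simp add: tail_measure_def emeasure_density)
  \<comment> \<open>Reflection at the origin turns the left tail into a right tail whose weight is
    b.\<close>
  also have "\<dots> = (\<integral>\<^sup>+w. ennreal (tail_density \<alpha> a b (0 + (-1) * w)) * indicator {..<-c} (0 +
      (-1) * w) \<partial>lborel)"
    by (subst nn_integral_real_affine[where c="-1" and t=0]) auto
  also have "\<dots> = (\<integral>\<^sup>+w. ennreal (tail_density \<alpha> b 0 w) * indicator {c<..} w \<partial>lborel)"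
    using \<open>c > 0\<close> by (intro nn_integral_cong) (auto simp: tail_density_def indicator_def)
  also have "\<dots> = emeasure (tail_measure \<alpha> b 0) {c<..}"
    by (simp add: tail_measure_def emeasure_density)
  finally show ?thesis using tail_measure_Ioi[of \<alpha> b c 0] assms by simp
qed

lemma measure_tail_measure:
  assumes "\<alpha> > 0" "a \<ge> 0" "b \<ge> 0" "c > 0"
  shows "measure (tail_measure \<alpha> a b) {c<..} = a * c powr - \<alpha>"
    and "measure (tail_measure \<alpha> a b) {..<-c} = b * c powr - \<alpha>"
    and "emeasure (tail_measure \<alpha> a b) {w. c < \<bar>w\<bar>} = ennreal ((a + b) * c powr - \<alpha>)"
    and "measure (tail_measure \<alpha> a b) {w. c < \<bar>w\<bar>} = (a + b) * c powr - \<alpha>"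
proof -
  show "measure (tail_measure \<alpha> a b) {c<..} = a * c powr - \<alpha>"
    "measure (tail_measure \<alpha> a b) {..<-c} = b * c powr - \<alpha>"
    using assms by (simp_all add: measure_def tail_measure_Ioi tail_measure_Iio)
  have "{w. c < \<bar>w\<bar>} = {c<..} \<union> {..<-c}"
    using assms by auto
  moreover have "{c<..} \<inter> {..<-c} = {}"
    using assms by auto
  ultimately show *: "emeasure (tail_measure \<alpha> a b) {w. c < \<bar>w\<bar>} = ennreal ((a + b) * c powr - \<alpha>)"
    using assms
    by (simp add: plus_emeasure[symmetric] tail_measure_Ioi tail_measure_Iio distrib_right)
  then show "measure (tail_measure \<alpha> a b) {w. c < \<bar>w\<bar>} = (a + b) * c powr - \<alpha>"
    using assms by (simp add: measure_def)
qed

lemma integral_uniform_measure: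
  fixes f :: "'b \<Rightarrow> real"
  assumes A: "A \<in> sets N" "emeasure N A \<noteq> 0" "emeasure N A \<noteq> \<infinity>" and f: "f \<in> borel_measurable N"
  shows "integral\<^sup>L (uniform_measure N A) f = (\<integral>w. indicat_real A w * f w \<partial>N) / measure N A"
proof -
  have "measure N A > 0"
    using A by (simp add: measure_def enn2real_positive_iff less_top zero_less_iff_neq_zero)
  have "uniform_measure N A = density N (\<lambda>w. ennreal (indicat_real A w / measure N A))"
    unfolding uniform_measure_def
  proof (rule density_cong)
    show "AE w in N. indicator A w / emeasure N A = ennreal (indicat_real A w / measure N A)"
      using A \<open>measure N A > 0\<close>
      by (auto simp: indicator_def emeasure_eq_ennreal_measure ennreal_1[symmetric] divide_ennreal simp del: ennreal_1)
  qed (use A in measurable)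
  then have "integral\<^sup>L (uniform_measure N A) f = (\<integral>w. (indicat_real A w / measure N A) *\<^sub>R f w \<partial>N)"
    using A f by (simp add: integral_density)
  then show ?thesis by simp
qed

section \<open>Convergence of scaled laws away from zero\<close>

text \<open>The normalising function \<open>q\<close> is left free rather than being the tail of
  \<open>Z\<close>: for the chain it is the tail of the observed variable, which turns division by
  \<open>q x\<close> into conditioning.\<close>

locale regularly_varying_tails = prob_space M for M :: "'a measure" +
  fixes Z :: "'a \<Rightarrow> real" and q :: "real \<Rightarrow> real" and \<alpha> a b :: real
  assumes Z [measurable]: "Z \<in> borel_measurable M"
    and q: "\<And>x. q x > 0" and \<alpha>: "\<alpha> > 0" and ab: "a \<ge> 0" "b \<ge> 0" "a + b > 0"
    and right_tail: "\<And>u. u > 0 \<Longrightarrow> ((\<lambda>x. prob {\<omega> \<in> space M. u * x < Z \<omega>} / q x)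
        \<longlongrightarrow> a * u powr - \<alpha>) at_top"
    and left_tail: "\<And>u. u > 0 \<Longrightarrow> ((\<lambda>x. prob {\<omega> \<in> space M. Z \<omega> < - (u * x)} / q x)
        \<longlongrightarrow> b * u powr - \<alpha>) at_top"
begin

abbreviation "\<rho> \<equiv> tail_measure \<alpha> a b"

lemma two_sided_tail:
  assumes "u > 0"
  shows "((\<lambda>x. prob {\<omega> \<in> space M. u * x < \<bar>Z \<omega>\<bar>} / q x) \<longlongrightarrow> (a + b) * u powr - \<alpha>) at_top"
proof -
  have "((\<lambda>x. prob {\<omega> \<in> space M. u * x < Z \<omega>} / q x + prob {\<omega> \<in> space M. Z \<omega> < - (u * x)} / q x)
    \<longlongrightarrow> a * u powr - \<alpha> + b * u powr - \<alpha>) at_top"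
    by (intro tendsto_add right_tail left_tail assms)
  moreover have "\<forall>\<^sub>F x in at_top. prob {\<omega> \<in> space M. u * x < Z \<omega>} / q x + prob {\<omega> \<in> space M. Z \<omega> < -
      (u * x)} / q x
      = prob {\<omega> \<in> space M. u * x < \<bar>Z \<omega>\<bar>} / q x"
    using eventually_gt_at_top[of 0]
  proof eventually_elim
    case (elim x)
    then have "0 < u * x" using assms by simp
    then have "{\<omega> \<in> space M. u * x < \<bar>Z \<omega>\<bar>}
        = {\<omega> \<in> space M. u * x < Z \<omega>} \<union> {\<omega> \<in> space M. Z \<omega> < - (u * x)}"
      "{\<omega> \<in> space M. u * x < Z \<omega>} \<inter> {\<omega> \<in> space M. Z \<omega> < - (u * x)} = {}"
      by auto
    then show ?case
      by (simp add: finite_measure_Union add_divide_distrib)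
  qed
  ultimately show ?thesis
    by (simp add: distrib_right) (rule Lim_transform_eventually)
qed

text \<open>Distribution functions at negative points involve closed half-lines. The closed tail at
  u lies between the open tails at u and at any v < u, and the limit is continuous in the
  level.\<close>

lemma left_tail_le:
  assumes "u > 0"
  shows "((\<lambda>x. prob {\<omega> \<in> space M. Z \<omega> \<le> - (u * x)} / q x) \<longlongrightarrow> b * u powr - \<alpha>) at_top"
proof (rule order_tendstoI)
  fix c assume "c < b * u powr - \<alpha>"
  from order_tendstoD(1)[OF left_tail[OF assms] this]
  show "\<forall>\<^sub>F x in at_top. c < prob {\<omega> \<in> space M. Z \<omega> \<le> - (u * x)} / q x"
  proof eventually_elim
    case (elim x)
    have "prob {\<omega> \<in> space M. Z \<omega> < - (u * x)} / q x \<le> prob {\<omega> \<in> space M. Z \<omega> \<le> - (u * x)} / q x"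
      by (intro divide_right_mono finite_measure_mono less_imp_le[OF q]) auto
    then show ?case using elim by simp
  qed
next
  fix c assume c: "c > b * u powr - \<alpha>"
  have "((\<lambda>v. b * v powr - \<alpha>) \<longlongrightarrow> b * u powr - \<alpha>) (at_left u)"
    using assms by (intro tendsto_intros) auto
  from order_tendstoD(2)[OF this c] eventually_at_left_real[OF assms]
  have "\<forall>\<^sub>F v in at_left u. b * v powr - \<alpha> < c \<and> v \<in> {0<..<u}"
    by (rule eventually_conj)
  then obtain v where v: "b * v powr - \<alpha> < c" "0 < v" "v < u"
    using eventually_happens'[OF trivial_limit_at_left_real[of u]] by fastforce
  from order_tendstoD(2)[OF left_tail[OF v(2)] v(1)] eventually_gt_at_top[of 0]
  show "\<forall>\<^sub>F x in at_top. prob {\<omega> \<in> space M. Z \<omega> \<le> - (u * x)} / q x < c"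
  proof eventually_elim
    case (elim x)
    then have "v * x < u * x" using v by simp
    then have "prob {\<omega> \<in> space M. Z \<omega> \<le> - (u * x)} / q x \<le> prob {\<omega> \<in> space M. Z \<omega> < - (v * x)} / q x"
      by (intro divide_right_mono finite_measure_mono less_imp_le[OF q]) auto
    then show ?case using elim by simp
  qed
qed


text \<open>Conditioned on |Z| > \<eta> x, the law of Z / x converges weakly to the normalised
  restriction of \<open>\<rho>\<close>. Skorohod's representation makes this pointwise convergence,
  along which h converges because it does so along the product filter at almost every point;
  domination by K finishes the argument.\<close>

lemma limit_above:
  fixes h :: "real \<Rightarrow> real \<Rightarrow> real"
  assumes \<eta>: "\<eta> > 0" and h [measurable]: "\<And>x. h x \<in> borel_measurable borel"
    and h' [measurable]: "h' \<in> borel_measurable borel" and K: "\<And>x w. \<bar>h x w\<bar> \<le> K"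
    and conv: "AE w in lborel. ((\<lambda>(x, v). h x v) \<longlongrightarrow> h' w) (at_top \<times>\<^sub>F nhds w)"
  shows "((\<lambda>x. (\<integral>w. indicat_real {w. \<eta> < \<bar>w\<bar>} w * h x w \<partial>distr M borel (\<lambda>\<omega>. Z \<omega> / x)) / q x)
    \<longlongrightarrow> (\<integral>w. indicat_real {w. \<eta> < \<bar>w\<bar>} w * h' w \<partial>\<rho>)) at_top"
proof (rule tendsto_at_topI_sequentially)
  fix X0 :: "nat \<Rightarrow> real" assume X0: "filterlim X0 at_top sequentially"
  define G where "G = {w::real. \<eta> < \<bar>w\<bar>}"
  have G [measurable]: "G \<in> sets borel" unfolding G_def by measurable
  define N where "N x = distr M borel (\<lambda>\<omega>. Z \<omega> / x)" for x
  have sets_N [measurable_cong]: "sets (N x) = sets borel" for x by (simp add: N_def)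
  have N_fin: "finite_measure (N x)" for x by (simp add: N_def finite_measure_distr)
  have N_meas: "measure (N x) S = prob {\<omega> \<in> space M. Z \<omega> / x \<in> S}" if "S \<in> sets borel" for x S
    using that by (simp add: N_def measure_distr vimage_def Int_def conj_commute)
  have NG: "measure (N x) G = prob {\<omega> \<in> space M. \<eta> * x < \<bar>Z \<omega>\<bar>}" if "x > 0" for x
    using that by (subst N_meas[OF G]) (simp add: G_def pos_less_divide_eq)
  define g where "g = (a + b) * \<eta> powr - \<alpha>"
  have g: "g > 0" using ab \<eta> by (simp add: g_def)
  have \<rho>G: "measure \<rho> G = g" "emeasure \<rho> G = ennreal g"
    using measure_tail_measure[OF \<alpha> ab(1,2) \<eta>] by (simp_all add: G_def g_def)
  have "((\<lambda>x. prob {\<omega> \<in> space M. \<eta> * x < \<bar>Z \<omega>\<bar>} / q x) \<longlongrightarrow> g) at_top"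
    unfolding g_def using two_sided_tail[OF \<eta>] .
  from eventually_compose_filterlim[OF eventually_conj[OF order_tendstoD(1)[OF this g] eventually_gt_at_top[of 0]] X0]
  obtain n0 where n0: "\<And>n. n \<ge> n0 \<Longrightarrow> 0 < prob {\<omega> \<in> space M. \<eta> * X0 n < \<bar>Z \<omega>\<bar>} / q (X0 n)"
      "\<And>n. n \<ge> n0 \<Longrightarrow> X0 n > 0"
    unfolding eventually_sequentially by blast
  \<comment> \<open>Dropping finitely many terms makes every conditioning event have positive
    probability.\<close>
  define X where "X n = X0 (n + n0)" for n
  have Xpos: "X n > 0" for n using n0(2) by (simp add: X_def)
  have X: "filterlim X at_top sequentially"
    unfolding X_def using X0 by (rule filterlim_compose) (rule filterlim_add_const_nat_at_top)
  have NXpos: "measure (N (X n)) G > 0" for n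
    using n0(1)[of "n + n0"] NG[OF Xpos] q[of "X n"] by (simp add: X_def zero_less_divide_iff)
  define \<pi> where "\<pi> n = uniform_measure (N (X n)) G" for n
  define \<pi>' where "\<pi>' = uniform_measure \<rho> G"
  have e\<pi>: "emeasure (N (X n)) G \<noteq> 0" "emeasure (N (X n)) G \<noteq> \<infinity>" for n
    using NXpos[of n] finite_measure.emeasure_finite[OF N_fin] by (auto simp: measure_def)
  have e\<pi>': "emeasure \<rho> G \<noteq> 0" "emeasure \<rho> G \<noteq> \<infinity>" using \<rho>G g by auto
  have rd: "real_distribution (\<pi> n)" for n
    unfolding real_distribution_def real_distribution_axioms_def \<pi>_def
    using prob_space_uniform_measure[OF e\<pi>] by (simp add: sets_N)
  have rd': "real_distribution \<pi>'"
    unfolding real_distribution_def real_distribution_axioms_def \<pi>'_def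
    using prob_space_uniform_measure[OF e\<pi>'] by simp
  have m\<pi>: "measure (\<pi> n) S
      = measure (N (X n)) (G \<inter> S) / measure (N (X n)) G" if "S \<in> sets borel" for n S
    unfolding \<pi>_def using that e\<pi>[of n] by (intro measure_uniform_measure) (auto simp: sets_N)
  have m\<pi>': "measure \<pi>' S = measure \<rho> (G \<inter> S) / g" if "S \<in> sets borel" for S
    unfolding \<pi>'_def \<rho>G(1)[symmetric] using that e\<pi>' by (intro measure_uniform_measure) auto
  have limG: "(\<lambda>n. measure (N (X n)) G / q (X n)) \<longlonglongrightarrow> g"
    using filterlim_compose[OF two_sided_tail[OF \<eta>] X] NG[OF Xpos] by (simp add: g_def)
  have ratio: "(\<lambda>n. measure (\<pi> n) S) \<longlonglongrightarrow> measure \<pi>' S"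
    if S: "S \<in> sets borel" and lim: "(\<lambda>n. measure (N (X n)) (G \<inter> S) / q (X n))
        \<longlonglongrightarrow> measure \<rho> (G \<inter> S)" for S
  proof -
    have "(\<lambda>n. (measure (N (X n)) (G \<inter> S) / q (X n)) / (measure (N (X n)) G / q (X n)))
        \<longlonglongrightarrow> measure \<rho> (G \<inter> S) / g"
      using lim limG g by (intro tendsto_divide) auto
    moreover have "(measure (N (X n)) (G \<inter> S) / q (X n)) / (measure (N (X n)) G / q (X n))
        = measure (\<pi> n) S" for n
      using m\<pi>[OF S] q[of "X n"] by simp
    ultimately show ?thesis by (simp add: m\<pi>'[OF S])
  qed
  \<comment> \<open>The cases split at -\<eta> so that each set, intersected with |w| > \<eta>, is a
    single half-line away from the origin: a right one here, a left one below.\<close>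
  have right: "(\<lambda>n. measure (\<pi> n) {c<..}) \<longlonglongrightarrow> measure \<pi>' {c<..}" if "c \<ge> - \<eta>" for c
  proof (rule ratio)
    define d where "d = max c \<eta>"
    have d: "d > 0" and GS: "G \<inter> {c<..} = {d<..}"
      using that \<eta> by (auto simp: G_def d_def)
    have "measure (N (X n)) {d<..} = prob {\<omega> \<in> space M. d * X n < Z \<omega>}" for n
      using Xpos[of n] by (subst N_meas) (simp_all add: field_simps)
    then show "(\<lambda>n. measure (N (X n)) (G \<inter> {c<..}) / q (X n)) \<longlonglongrightarrow> measure \<rho> (G \<inter> {c<..})"
      unfolding GS using filterlim_compose[OF right_tail[OF d] X] measure_tail_measure[OF \<alpha> ab(1,2) d] by simp
  qed simp
  have left: "(\<lambda>n. measure (\<pi> n) {..c}) \<longlonglongrightarrow> measure \<pi>' {..c}" if "c < - \<eta>" for c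
  proof (rule ratio)
    define d where "d = - c"
    have d: "d > 0" and GS: "G \<inter> {..c} = {..-d}"
      using that \<eta> by (auto simp: G_def d_def)
    have "measure (N (X n)) {..-d} = prob {\<omega> \<in> space M. Z \<omega> \<le> - (d * X n)}" for n
      using Xpos[of n] by (subst N_meas) (simp_all add: field_simps)
    \<comment> \<open>The limit measure has a density, so the endpoint carries no mass.\<close>
    moreover have "measure \<rho> {..-d} = measure \<rho> {..<-d}"
    proof -
      have "AE w in \<rho>. w \<noteq> -d"
        by (intro AE_tail_measure AE_lborel_singleton)
      then show ?thesis
        by (intro measure_eq_AE) auto
    qed
    ultimately show "(\<lambda>n. measure (N (X n)) (G \<inter> {..c}) / q (X n)) \<longlonglongrightarrow> measure \<rho> (G \<inter> {..c})"
      unfolding GS using filterlim_compose[OF left_tail_le[OF d] X] measure_tail_measure[OF \<alpha> ab(1,2) d] by simp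
  qed simp
  have "weak_conv_m \<pi> \<pi>'"
    unfolding weak_conv_m_def weak_conv_def
  proof (intro allI impI)
    fix c
    have cdf: "cdf P c = 1 - measure P {c<..}" if "real_distribution P" for P
    proof -
      interpret P: real_distribution P by fact
      have "UNIV - {c<..} = {..c}" by auto
      then show ?thesis using P.prob_compl[of "{c<..}"] by (simp add: cdf_def)
    qed
    show "(\<lambda>n. cdf (\<pi> n) c) \<longlonglongrightarrow> cdf \<pi>' c"
    proof (cases "c < - \<eta>")
      case True
      then show ?thesis using left by (simp add: cdf_def)
    next
      case False
      then show ?thesis unfolding cdf[OF rd] cdf[OF rd']
          by (intro tendsto_diff tendsto_const right) auto
    qed
  qed
  from Skorohod[OF rd rd' this] obtain \<Omega> :: "real measure" and W :: "nat \<Rightarrow> real \<Rightarrow> real"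
      and W' :: "real \<Rightarrow> real"
    where \<Omega>: "prob_space \<Omega>" and W: "\<And>n. W n \<in> borel_measurable \<Omega>" "\<And>n. distr \<Omega> borel (W n) = \<pi> n"
      and W': "W' \<in> borel_measurable \<Omega>" "distr \<Omega> borel W' = \<pi>'"
      and WW': "\<And>\<omega>. \<omega> \<in> space \<Omega> \<Longrightarrow> (\<lambda>n. W n \<omega>) \<longlonglongrightarrow> W' \<omega>"
    unfolding measurable_lborel1 by blast
  note [measurable] = W(1) W'(1)
  interpret \<Omega>: prob_space \<Omega> by fact
  have "AE w in \<pi>'. ((\<lambda>(x, v). h x v) \<longlongrightarrow> h' w) (at_top \<times>\<^sub>F nhds w)"
    unfolding \<pi>'_def by (intro AE_uniform_measureI eventually_mono[OF AE_tail_measure[OF conv]]) simp_all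
  then have AEW: "AE \<omega> in \<Omega>. ((\<lambda>(x, v). h x v) \<longlongrightarrow> h' (W' \<omega>)) (at_top \<times>\<^sub>F nhds (W' \<omega>))"
    unfolding W'(2)[symmetric] by (rule AE_distrD[OF W'(1)])
  have "(\<lambda>n. \<integral>\<omega>. h (X n) (W n \<omega>) \<partial>\<Omega>) \<longlonglongrightarrow> (\<integral>\<omega>. h' (W' \<omega>) \<partial>\<Omega>)"
  proof (rule integral_dominated_convergence[where w="\<lambda>_. K"])
    show "AE \<omega> in \<Omega>. (\<lambda>n. h (X n) (W n \<omega>)) \<longlonglongrightarrow> h' (W' \<omega>)"
      using AEW AE_space
    proof eventually_elim
      case (elim \<omega>)
      from filterlim_compose[OF elim(1) filterlim_Pair[OF X WW'[OF elim(2)]]]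
      show ?case by simp
    qed
  qed (use K in auto)
  moreover have "(\<integral>\<omega>. h (X n) (W n \<omega>) \<partial>\<Omega>) = integral\<^sup>L (\<pi> n) (h (X n))" for n
    unfolding W(2)[symmetric] by (rule integral_distr[symmetric]) auto
  moreover have "(\<integral>\<omega>. h' (W' \<omega>) \<partial>\<Omega>) = integral\<^sup>L \<pi>' h'"
    unfolding W'(2)[symmetric] by (rule integral_distr[symmetric]) auto
  ultimately have "(\<lambda>n. integral\<^sup>L (\<pi> n) (h (X n))) \<longlonglongrightarrow> integral\<^sup>L \<pi>' h'"
    by simp
  \<comment> \<open>Multiplying by the normalised mass of |w| > \<eta> undoes the
    conditioning.\<close>
  from tendsto_mult[OF this limG]
  have "(\<lambda>n. integral\<^sup>L (\<pi> n) (h (X n)) * (measure (N (X n)) G / q (X n))) \<longlonglongrightarrow> integral\<^sup>L \<pi>' h' * g" .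
  moreover have "integral\<^sup>L (\<pi> n) (h (X n)) * (measure (N (X n)) G / q (X n))
      = (\<integral>w. indicat_real G w * h (X n) w \<partial>N (X n)) / q (X n)" for n
    unfolding \<pi>_def using NXpos[of n] e\<pi>[of n] by (subst integral_uniform_measure) auto
  moreover have "integral\<^sup>L \<pi>' h' * g = (\<integral>w. indicat_real G w * h' w \<partial>\<rho>)"
    unfolding \<pi>'_def using e\<pi>' g \<rho>G(1) by (subst integral_uniform_measure) auto
  ultimately have "(\<lambda>n. (\<integral>w. indicat_real G w * h (X n) w \<partial>N (X n)) / q (X n))
      \<longlonglongrightarrow> (\<integral>w. indicat_real G w * h' w \<partial>\<rho>)"
    by (simp only:)
  then have "(\<lambda>n. (\<integral>w. indicat_real G w * h (X0 n) w \<partial>N (X0 n)) / q (X0 n))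
      \<longlonglongrightarrow> (\<integral>w. indicat_real G w * h' w \<partial>\<rho>)"
    unfolding X_def by (rule LIMSEQ_offset)
  then show "(\<lambda>n. (\<integral>w. indicat_real {w. \<eta> < \<bar>w\<bar>} w * h (X0 n) w \<partial>distr M borel (\<lambda>\<omega>. Z \<omega> / X0 n)) / q
      (X0 n))
    \<longlonglongrightarrow> (\<integral>w. indicat_real {w. \<eta> < \<bar>w\<bar>} w * h' w \<partial>\<rho>)"
    unfolding N_def G_def .
qed

text \<open>By independence, Fubini allows U to be frozen: for each value u the one-dimensional
  limit applies with its own exceptional null set, and the inner integrals are dominated uniformly
  in u.\<close>

lemma limit_above_indep:
  fixes h :: "real \<Rightarrow> real \<Rightarrow> 'u \<Rightarrow> real" and U :: "'a \<Rightarrow> 'u"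
  assumes \<eta>: "\<eta> > 0" and U [measurable]: "U \<in> measurable M S"
    and joint: "distr M (borel \<Otimes>\<^sub>M S) (\<lambda>\<omega>. (Z \<omega>, U \<omega>)) = distr M borel Z \<Otimes>\<^sub>M distr M S U"
    and h [measurable]: "\<And>x. case_prod (h x) \<in> borel_measurable (borel \<Otimes>\<^sub>M S)"
    and h' [measurable]: "case_prod h' \<in> borel_measurable (borel \<Otimes>\<^sub>M S)"
    and K: "\<And>x w u. \<bar>h x w u\<bar> \<le> K" "\<And>w u. \<bar>h' w u\<bar> \<le> K"
    and conv: "\<And>u. u \<in> space S \<Longrightarrow>
      AE w in lborel. ((\<lambda>(x, v). h x v u) \<longlongrightarrow> h' w u) (at_top \<times>\<^sub>F nhds w)"
  shows "((\<lambda>x. (\<integral>\<omega>. indicat_real {w. \<eta> < \<bar>w\<bar>} (Z \<omega> / x) * h x (Z \<omega> / x) (U \<omega>) \<partial>M) / q x)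
    \<longlongrightarrow> (\<integral>(w, u). indicat_real {w. \<eta> < \<bar>w\<bar>} w * h' w u \<partial>(\<rho> \<Otimes>\<^sub>M distr M S U))) at_top"
proof -
  define G where "G = {w::real. \<eta> < \<bar>w\<bar>}"
  have G [measurable]: "G \<in> sets borel" unfolding G_def by measurable
  define N where "N x = distr M borel (\<lambda>\<omega>. Z \<omega> / x)" for x
  have sets_N [measurable_cong]: "sets (N x) = sets borel" for x by (simp add: N_def)
  define Q where "Q = distr M S U"
  have sets_Q [measurable_cong]: "sets Q = sets S" by (simp add: Q_def)
  interpret Q: prob_space Q unfolding Q_def by (rule prob_space_distr) simp
  interpret DZ: prob_space "distr M borel Z" by (rule prob_space_distr) simp
  interpret \<rho>: sigma_finite_measure \<rho> by (rule sigma_finite_tail_measure)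
  interpret P: pair_prob_space "distr M borel Z" Q ..
  interpret R: pair_sigma_finite \<rho> Q ..
  have K0: "K \<ge> 0" using K(2)[of undefined undefined] by linarith
  have sec [measurable]: "(\<lambda>w. h x w u) \<in> borel_measurable borel"
      "(\<lambda>w. h' w u) \<in> borel_measurable borel"
    if "u \<in> space S" for x u
    using that measurable_compose[OF measurable_Pair2' h] measurable_compose[OF measurable_Pair2' h'] by auto
  have fub: "(\<integral>\<omega>. indicat_real G (Z \<omega> / x) * h x (Z \<omega> / x) (U \<omega>) \<partial>M)
      = (\<integral>u. (\<integral>w. indicat_real G w * h x w u \<partial>N x) \<partial>Q)" for x
  proof -
    have int: "integrable (distr M borel Z \<Otimes>\<^sub>M Q) (\<lambda>(z, u). indicat_real G (z / x) * h x (z / x) u)"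
      using K(1) K0 by (intro P.P.integrable_const_bound[where B=K]) (auto simp: indicator_def)
    have "(\<integral>\<omega>. indicat_real G (Z \<omega> / x) * h x (Z \<omega> / x) (U \<omega>) \<partial>M)
        = (\<integral>(z, u). indicat_real G (z / x) * h x (z / x) u \<partial>distr M (borel \<Otimes>\<^sub>M S) (\<lambda>\<omega>. (Z \<omega>, U \<omega>)))"
      by (subst integral_distr) auto
    also have "\<dots> = (\<integral>u. (\<integral>z. indicat_real G (z / x) * h x (z / x) u \<partial>distr M borel Z) \<partial>Q)"
      unfolding joint Q_def[symmetric] by (rule P.integral_snd[OF int, symmetric])
    also have "\<dots> = (\<integral>u. (\<integral>w. indicat_real G w * h x w u \<partial>N x) \<partial>Q)"
    proof (rule Bochner_Integration.integral_cong[OF refl])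
      fix u assume "u \<in> space Q"
      then have [measurable]: "u \<in> space S" by (simp add: Q_def)
      show "(\<integral>z. indicat_real G (z / x) * h x (z / x) u \<partial>distr M borel Z)
          = (\<integral>w. indicat_real G w * h x w u \<partial>N x)"
        unfolding N_def by (simp add: integral_distr)
    qed
    finally show ?thesis .
  qed
  have \<rho>G: "emeasure \<rho> G < \<infinity>"
    using measure_tail_measure(3)[OF \<alpha> ab(1,2) \<eta>] by (simp add: G_def)
  have "integrable (\<rho> \<Otimes>\<^sub>M Q) (\<lambda>(w, u). indicat_real G w * h' w u)"
  proof (rule integrableI_bounded_set[where A="G \<times> space Q" and B=K])
    show "emeasure (\<rho> \<Otimes>\<^sub>M Q) (G \<times> space Q) < \<infinity>"
      using \<rho>G Q.emeasure_space_1 by (subst Q.emeasure_pair_measure_Times) auto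
  qed (use K K0 in \<open>auto simp: indicator_def space_pair_measure\<close>)
  then have lim: "(\<integral>(w, u). indicat_real G w * h' w u \<partial>(\<rho> \<Otimes>\<^sub>M Q))
      = (\<integral>u. (\<integral>w. indicat_real G w * h' w u \<partial>\<rho>) \<partial>Q)"
    by (rule R.integral_snd[symmetric])
  have "((\<lambda>x. \<integral>u. (\<integral>w. indicat_real G w * h x w u \<partial>N x) / q x \<partial>Q)
      \<longlongrightarrow> (\<integral>u. (\<integral>w. indicat_real G w * h' w u \<partial>\<rho>) \<partial>Q)) at_top"
  proof (rule integral_dominated_convergence_at_top)
    \<comment> \<open>The tail quotient tends to g, hence is eventually below g + 1; this gives a
      dominating constant that does not depend on u.\<close>
    define g where "g = (a + b) * \<eta> powr - \<alpha>"
    show "integrable Q (\<lambda>_. K * (g + 1))" by simp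
    show "AE u in Q. ((\<lambda>x. (\<integral>w. indicat_real G w * h x w u \<partial>N x) / q x)
        \<longlongrightarrow> (\<integral>w. indicat_real G w * h' w u \<partial>\<rho>)) at_top"
    proof (rule AE_I2)
      fix u assume "u \<in> space Q"
      then have u: "u \<in> space S" by (simp add: Q_def)
      show "((\<lambda>x. (\<integral>w. indicat_real G w * h x w u \<partial>N x) / q x)
        \<longlongrightarrow> (\<integral>w. indicat_real G w * h' w u \<partial>\<rho>)) at_top"
        unfolding N_def G_def by (rule limit_above[OF \<eta> sec[OF u] K(1) conv[OF u]])
    qed
    have "((\<lambda>x. prob {\<omega> \<in> space M. \<eta> * x < \<bar>Z \<omega>\<bar>} / q x) \<longlongrightarrow> g) at_top"
      unfolding g_def by (rule two_sided_tail[OF \<eta>])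
    then have "\<forall>\<^sub>F x in at_top. prob {\<omega> \<in> space M. \<eta> * x < \<bar>Z \<omega>\<bar>} / q x < g + 1"
      by (rule order_tendstoD(2)) simp
    then show "\<forall>\<^sub>F x in at_top. AE u in Q. norm ((\<integral>w. indicat_real G w * h x w u \<partial>N x) / q x)
        \<le> K * (g + 1)"
      using eventually_gt_at_top[of 0]
    proof eventually_elim
      case (elim x)
      interpret N: prob_space "N x" unfolding N_def by (rule prob_space_distr) simp
      have NG: "measure (N x) G = prob {\<omega> \<in> space M. \<eta> * x < \<bar>Z \<omega>\<bar>}"
        using elim(2) by (simp add: N_def measure_distr vimage_def Int_def conj_commute G_def pos_less_divide_eq)
      show ?case
      proof (rule AE_I2)
        fix u assume "u \<in> space Q"
        then have [measurable]: "u \<in> space S" by (simp add: Q_def)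
        have "\<bar>\<integral>w. indicat_real G w * h x w u \<partial>N x\<bar> \<le> (\<integral>w. \<bar>indicat_real G w * h x w u\<bar> \<partial>N x)"
          using integral_norm_bound[of "N x" "\<lambda>w. indicat_real G w * h x w u"] by simp
        also have "\<dots> \<le> (\<integral>w. indicat_real G w * K \<partial>N x)"
          using K(1) K0 by (intro integral_mono N.integrable_const_bound[where B=K])
            (auto simp: indicator_def)
        also have "\<dots> = K * measure (N x) G"
          by simp
        finally have "\<bar>\<integral>w. indicat_real G w * h x w u \<partial>N x\<bar> / q x \<le> K * measure (N x) G / q x"
          using q[of x] by (intro divide_right_mono) auto
        also have "\<dots> \<le> K * (g + 1)"
          using elim(1) K0 NG by (simp add: mult_left_mono flip: times_divide_eq_right)
        finally show "norm ((\<integral>w. indicat_real G w * h x w u \<partial>N x) / q x) \<le> K * (g + 1)"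
          using q[of x] by simp
      qed
    qed
    have "finite_measure (N x)" for x by (simp add: N_def finite_measure_distr)
    then have [measurable]: "sigma_finite_measure (N x)" for x by (simp add: finite_measure_def)
    show "(\<lambda>u. \<integral>w. indicat_real G w * h' w u \<partial>\<rho>) \<in> borel_measurable Q"
      by (rule \<rho>.borel_measurable_lebesgue_integral) measurable
    show "(\<lambda>u. (\<integral>w. indicat_real G w * h x w u \<partial>N x) / q x) \<in> borel_measurable Q" for x
      by (intro borel_measurable_divide borel_measurable_const
        sigma_finite_measure.borel_measurable_lebesgue_integral[of "N x"]) measurable
  qed
  then show ?thesis
    unfolding G_def[symmetric] fub Q_def[symmetric] lim by simp
qed

end

section \<open>Paths of the scaled recursion\<close>

text \<open>With the innovation frozen, convergence along curves becomes joint convergence in (x,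
  w), the form in which limits can be composed along the recursion.\<close>

lemma filterlim_if_scaling_limit:
  fixes F :: "real \<Rightarrow> 'b \<Rightarrow> real"
  assumes "scaling_limit T F f" "v \<in> topspace T"
  shows "((\<lambda>(x, w). F (x * w) v / x) \<longlongrightarrow> w0 * f v (sign_pm w0)) (at_top \<times>\<^sub>F nhds w0)"
proof (rule filterlim_prod_if_curves)
  fix W :: "real \<Rightarrow> real" assume "(W \<longlongrightarrow> w0) at_top"
  moreover have "limitin T (\<lambda>_. v) v at_top"
    using assms(2) by simp
  ultimately show "((\<lambda>x. F (x * W x) v / x) \<longlongrightarrow> w0 * f v (sign_pm w0)) at_top"
    using assms(1) unfolding scaling_limit_def by blast
qed

text \<open>Measurability of the limit function is not assumed but inherited: the product w * f v
  (sign w) is a pointwise limit of the measurable rescaled maps.\<close>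

lemma borel_measurable_scaling_limit:
  fixes F :: "real \<Rightarrow> 'b \<Rightarrow> real"
  assumes F [measurable]: "case_prod F \<in> borel_measurable (borel \<Otimes>\<^sub>M S)"
    and "scaling_limit T F f" and S: "space S \<subseteq> topspace T"
  shows "(\<lambda>(w, v). w * f v (sign_pm w)) \<in> borel_measurable (borel \<Otimes>\<^sub>M S)"
proof (rule borel_measurable_LIMSEQ_real)
  show "(\<lambda>(w, v). F (real n * w) v / real n) \<in> borel_measurable (borel \<Otimes>\<^sub>M S)" for n
    by measurable
  fix p :: "real \<times> 'b" assume "p \<in> space (borel \<Otimes>\<^sub>M S)"
  then obtain w :: real and v where p: "p = (w, v)" and v: "v \<in> topspace T"
    using S by (auto simp: space_pair_measure)
  have "(\<lambda>n. (\<lambda>(x, w). F (x * w) v / x) (real n, w)) \<longlonglongrightarrow> w * f v (sign_pm w)"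
    by (rule filterlim_compose[OF filterlim_if_scaling_limit[OF assms(2) v]
      filterlim_Pair[OF filterlim_real_sequentially tendsto_const]])
  then show "(\<lambda>n. (\<lambda>(w, v). F (real n * w) v / real n) p) \<longlonglongrightarrow> (\<lambda>(w, v). w * f v (sign_pm w)) p"
    by (simp add: p)
qed

text \<open>The path of the recursion \<open>y (t + 1) = F (y t) (u (t + 1))\<close> started from \<open>w\<close> at time \<open>j\<close>.\<close>

primrec orbit :: "(real \<Rightarrow> 's \<Rightarrow> real) \<Rightarrow> int \<Rightarrow> (int \<Rightarrow> 's) \<Rightarrow> real \<Rightarrow> nat \<Rightarrow> real" where
  "orbit F j u w 0 = w"
| "orbit F j u w (Suc i) = F (orbit F j u w i) (u (j + 1 + int i))"

lemma borel_measurable_orbit: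
  assumes [measurable]: "case_prod F \<in> borel_measurable (borel \<Otimes>\<^sub>M N)"
  shows "(\<lambda>(w, u). orbit F j u w i) \<in> borel_measurable (borel \<Otimes>\<^sub>M (\<Pi>\<^sub>M t\<in>{j<..}. N))"
proof (induction i)
  case (Suc i)
  note [measurable] = Suc
  have [measurable]: "(\<lambda>u. u (j + 1 + int i)) \<in> measurable (\<Pi>\<^sub>M t\<in>{j<..}. N) N"
    by (rule measurable_component_singleton) auto
  show ?case by simp measurable
qed simp

text \<open>Product-filter limits compose, provided the scale x is carried along in the first
  component; this is why each step pairs the previous limit with \<open>fst\<close>.\<close>

lemma filterlim_orbit:
  fixes F :: "real \<Rightarrow> real \<Rightarrow> 's \<Rightarrow> real"
  assumes "\<And>w v. ((\<lambda>(x, w). F x w v) \<longlongrightarrow> F' w v) (at_top \<times>\<^sub>F nhds w)"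
  shows "((\<lambda>(x, w). orbit (F x) j u w i) \<longlongrightarrow> orbit F' j u w i) (at_top \<times>\<^sub>F nhds w)"
proof (induction i)
  case 0
  show ?case using filterlim_snd[of "nhds w" "at_top :: real filter"] by (simp add: case_prod_unfold)
next
  case (Suc i)
  have "filterlim (\<lambda>p. (fst p, (\<lambda>(x, w). orbit (F x) j u w i) p)) (at_top \<times>\<^sub>F nhds
      (orbit F' j u w i)) (at_top \<times>\<^sub>F nhds w)"
    by (rule filterlim_Pair[OF filterlim_fst Suc])
  from filterlim_compose[OF assms this]
  show ?case by (simp add: case_prod_unfold)
qed

lemma orbit_homogeneous:
  assumes "\<And>w v. F (c * w) v = c * F w v"
  shows "orbit F j u (c * w) i = c * orbit F j u w i"
  by (induction i) (simp_all add: assms)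

section \<open>Tails and independence from the hypotheses\<close>

text \<open>A quotient with denominator zero is zero, so the limit one obtained for u = 1 excludes
  vanishing denominators for large x. Monotonicity of the tail then gives positivity for all
  x.\<close>

lemma regularly_varying_nonzero:
  assumes "balanced_regularly_varying M Z \<alpha> p"
  shows "\<forall>\<^sub>F x in at_top. measure M {\<omega> \<in> space M. \<bar>Z \<omega>\<bar> > x} > 0"
proof -
  have "((\<lambda>x. measure M {\<omega> \<in> space M. \<bar>Z \<omega>\<bar> > 1 * x} / measure M {\<omega> \<in> space M. \<bar>Z \<omega>\<bar> > x})
      \<longlongrightarrow> 1 powr - \<alpha>) at_top"
    using assms unfolding balanced_regularly_varying_def by (meson zero_less_one)
  then have "\<forall>\<^sub>F x in at_top. 0 < measure M {\<omega> \<in> space M. \<bar>Z \<omega>\<bar> > 1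
      * x} / measure M {\<omega> \<in> space M. \<bar>Z \<omega>\<bar> > x}"
    by (rule order_tendstoD(1)) simp
  then show ?thesis
  proof eventually_elim
    case (elim x)
    then have "measure M {\<omega> \<in> space M. \<bar>Z \<omega>\<bar> > x} \<noteq> 0" by auto
    then show ?case by (simp add: order_less_le)
  qed
qed

lemma (in prob_space) regularly_varying_pos:
  assumes "balanced_regularly_varying M Z \<alpha> p" and [measurable]: "Z \<in> borel_measurable M"
  shows "prob {\<omega> \<in> space M. \<bar>Z \<omega>\<bar> > x} > 0"
proof -
  obtain y where "y \<ge> x" "prob {\<omega> \<in> space M. \<bar>Z \<omega>\<bar> > y} > 0"
    using eventually_conj[OF regularly_varying_nonzero[OF assms(1)] eventually_ge_at_top[of x]]
      eventually_happens'[OF trivial_limit_at_top_linorder] by blast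
  moreover have "prob {\<omega> \<in> space M. \<bar>Z \<omega>\<bar> > y} \<le> prob {\<omega> \<in> space M. \<bar>Z \<omega>\<bar> > x}"
    using \<open>y \<ge> x\<close> by (intro finite_measure_mono) auto
  ultimately show ?thesis by linarith
qed

text \<open>Passing from the tail of \<open>Y\<close> to that of \<open>V\<close> as normalisation
  divides the limits by C. The left tail is the two-sided tail minus the right one, whence the
  weight 1 - p.\<close>

lemma (in prob_space) balanced_regularly_varying_tails:
  assumes Y [measurable]: "Y \<in> borel_measurable M" and V [measurable]: "V \<in> borel_measurable M"
    and rv: "balanced_regularly_varying M Y \<alpha> p" and rv': "balanced_regularly_varying M V \<alpha>' p'"
    and C: "((\<lambda>x. prob {\<omega> \<in> space M. \<bar>V \<omega>\<bar> > x} / prob {\<omega> \<in> space M. \<bar>Y \<omega>\<bar> > x}) \<longlongrightarrow> C) at_top"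
    and "\<alpha> > 0" "p \<in> {0..1}" "C > 0"
  shows "regularly_varying_tails M Y (\<lambda>x. prob {\<omega> \<in> space M. \<bar>V \<omega>\<bar> > x}) \<alpha> (p / C) ((1 - p) / C)"
proof -
  define r where "r x = prob {\<omega> \<in> space M. \<bar>Y \<omega>\<bar> > x}" for x
  define q where "q x = prob {\<omega> \<in> space M. \<bar>V \<omega>\<bar> > x}" for x
  have r: "r x > 0" and q: "q x > 0" for x
    unfolding r_def q_def by (rule regularly_varying_pos[OF rv Y], rule regularly_varying_pos[OF rv' V])
  have both: "((\<lambda>x. r (u * x) / q x) \<longlongrightarrow> u powr - \<alpha> / C) at_top" if "u > 0" for u
  proof -
    have "((\<lambda>x. r (u * x) / r x) \<longlongrightarrow> u powr - \<alpha>) at_top"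
      using rv that unfolding balanced_regularly_varying_def r_def by blast
    from tendsto_divide[OF this C[folded r_def q_def]]
    have "((\<lambda>x. (r (u * x) / r x) / (q x / r x)) \<longlongrightarrow> u powr - \<alpha> / C) at_top"
      using \<open>C > 0\<close> by simp
    moreover have "(r (u * x) / r x) / (q x / r x) = r (u * x) / q x" for x
      using r[of x] by simp
    ultimately show ?thesis by (simp only:)
  qed
  have right: "((\<lambda>x. prob {\<omega> \<in> space M. u * x < Y \<omega>} / q x)
      \<longlongrightarrow> p / C * u powr - \<alpha>) at_top" if "u > 0" for u
  proof -
    have "((\<lambda>x. prob {\<omega> \<in> space M. x < Y \<omega>} / r x) \<longlongrightarrow> p) at_top"
      using rv unfolding balanced_regularly_varying_def r_def by blast
    then have "((\<lambda>x. prob {\<omega> \<in> space M. u * x < Y \<omega>} / r (u * x)) \<longlongrightarrow> p) at_top"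
      by (rule filterlim_compose) (use that in real_asymp)
    from tendsto_mult[OF this both[OF that]]
    show ?thesis using r by (simp add: less_imp_neq[OF r, symmetric] mult.commute)
  qed
  have left: "((\<lambda>x. prob {\<omega> \<in> space M. Y \<omega> < - (u * x)} / q x)
      \<longlongrightarrow> (1 - p) / C * u powr - \<alpha>) at_top" if "u > 0" for u
  proof (rule Lim_transform_eventually)
    show "((\<lambda>x. r (u * x) / q x - prob {\<omega> \<in> space M. u * x < Y \<omega>} / q x)
        \<longlongrightarrow> (1 - p) / C * u powr - \<alpha>) at_top"
      using tendsto_diff[OF both[OF that] right[OF that]]
          by (simp add: left_diff_distrib diff_divide_distrib)
    show "\<forall>\<^sub>F x in at_top. r (u * x) / q x - prob {\<omega> \<in> space M. u * x < Y \<omega>} / q x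
        = prob {\<omega> \<in> space M. Y \<omega> < - (u * x)} / q x"
      using eventually_gt_at_top[of 0]
    proof eventually_elim
      case (elim x)
      then have "0 < u * x" using that by simp
      then have "{\<omega> \<in> space M. u * x < \<bar>Y \<omega>\<bar>} - {\<omega> \<in> space M. u * x < Y \<omega>}
          = {\<omega> \<in> space M. Y \<omega> < - (u * x)}"
        "{\<omega> \<in> space M. u * x < Y \<omega>} \<subseteq> {\<omega> \<in> space M. u * x < \<bar>Y \<omega>\<bar>}"
        by auto
      then have "prob {\<omega> \<in> space M. Y \<omega> < - (u * x)} = r (u * x) - prob {\<omega> \<in> space M. u * x < Y \<omega>}"
        unfolding r_def using finite_measure_Diff[of "{\<omega> \<in> space M. u * x < \<bar>Y \<omega>\<bar>}"
            "{\<omega> \<in> space M. u * x < Y \<omega>}"]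
        by simp
      then show ?case by (simp add: diff_divide_distrib)
    qed
  qed
  have "regularly_varying_tails M Y q \<alpha> (p / C) ((1 - p) / C)"
  proof
    show "0 < p / C + (1 - p) / C" using assms by (simp flip: add_divide_distrib)
  qed (use assms q right left in auto)
  then show ?thesis unfolding q_def .
qed

lemma (in prob_space) stationary_prob:
  assumes "stationary M Y" and [measurable]: "\<And>t. Y t \<in> borel_measurable M" and S: "S \<in> sets borel"
  shows "prob {\<omega> \<in> space M. Y t \<omega> \<in> S} = prob {\<omega> \<in> space M. Y 0 \<omega> \<in> S}"
proof -
  let ?P = "\<Pi>\<^sub>M t\<in>{0::int}. (borel :: real measure)"
  have eq: "distr M ?P (\<lambda>\<omega>. \<lambda>i\<in>{0}. Y (i + t) \<omega>) = distr M ?P (\<lambda>\<omega>. \<lambda>i\<in>{0}. Y i \<omega>)"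
    using assms(1) unfolding stationary_def by blast
  have S' [measurable]: "{f \<in> space ?P. f 0 \<in> S} \<in> sets ?P"
    using S by measurable
  have *: "measure (distr M ?P (\<lambda>\<omega>. \<lambda>i\<in>{0}. Z i \<omega>)) {f \<in> space ?P. f 0 \<in> S}
      = prob {\<omega> \<in> space M. Z 0 \<omega> \<in> S}"
    if [measurable]: "\<And>i. Z i \<in> borel_measurable M" for Z :: "int \<Rightarrow> 'a \<Rightarrow> real"
    by (subst measure_distr) (auto intro!: arg_cong[where f=prob] simp: space_PiM)
  show ?thesis
    using *[of "\<lambda>i. Y (i + t)"] *[of Y] eq by simp
qed

text \<open>Rectangles determine the joint law, and the two sides of a rectangle pull back to events
  generated by the innovations after j and by the past up to j.\<close>

lemma (in prob_space) joint_law_innovations_past: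
  assumes indep: "innovations_indep_past M \<epsilon> Y"
    and \<epsilon>: "\<And>t. \<epsilon> t \<in> borel_measurable M" and Y: "\<And>t. Y t \<in> borel_measurable M"
  defines "S \<equiv> \<lambda>j. \<Pi>\<^sub>M t\<in>{j<..}. borel" and "U \<equiv> \<lambda>j \<omega>. \<lambda>t\<in>{j<..}. \<epsilon> t \<omega>"
  shows "distr M (borel \<Otimes>\<^sub>M S j) (\<lambda>\<omega>. (Y j \<omega>, U j \<omega>)) = distr M borel (Y j) \<Otimes>\<^sub>M distr M (S j) (U j)"
proof (rule pair_measure_eqI[symmetric])
  have U [measurable]: "U j \<in> measurable M (S j)"
    unfolding U_def S_def using \<epsilon> by measurable
  note [measurable] = Y
  show "sigma_finite_measure (distr M borel (Y j))" "sigma_finite_measure (distr M (S j) (U j))"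
    by (simp_all add: prob_space_distr prob_space_imp_sigma_finite)
  fix A B assume "A \<in> sets (distr M borel (Y j))" "B \<in> sets (distr M (S j) (U j))"
  then have A [measurable]: "A \<in> sets borel" and B [measurable]: "B \<in> sets (S j)" by auto
  let ?EA = "Y j -` A \<inter> space M" and ?EB = "U j -` B \<inter> space M"
  have "?EB \<in> generated_events M {j<..} \<epsilon>"
    unfolding generated_events_def using B by (simp add: S_def U_def in_vimage_algebra)
  moreover have "?EA \<in> generated_events M {..j} Y"
  proof -
    let ?P = "\<Pi>\<^sub>M t\<in>{..j}. (borel :: real measure)"
    have [measurable]: "(\<lambda>f. f j) \<in> borel_measurable ?P"
      by (rule measurable_component_singleton) simp
    have "(\<lambda>f. f j) -` A \<inter> space ?P \<in> sets ?P" by measurable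
    then have "(\<lambda>\<omega>. \<lambda>t\<in>{..j}. Y t \<omega>) -`
        ((\<lambda>f. f j) -` A \<inter> space ?P) \<inter> space M \<in> generated_events M {..j} Y"
      unfolding generated_events_def by (rule in_vimage_algebra)
    also have "(\<lambda>\<omega>. \<lambda>t\<in>{..j}. Y t \<omega>) -` ((\<lambda>f. f j) -` A \<inter> space ?P) \<inter> space M = ?EA"
      by (auto simp: space_PiM)
    finally show ?thesis .
  qed
  moreover have "indep_set (generated_events M {j<..} \<epsilon>) (generated_events M {..j} Y)"
    using indep unfolding innovations_indep_past_def by blast
  ultimately have "prob (?EB \<inter> ?EA) = prob ?EB * prob ?EA"
    by (intro indep_setD)
  moreover have "(\<lambda>\<omega>. (Y j \<omega>, U j \<omega>)) -` (A \<times> B) \<inter> space M = ?EB \<inter> ?EA" by auto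
  ultimately show "emeasure (distr M borel (Y j)) A * emeasure (distr M (S j) (U j)) B
      = emeasure (distr M (borel \<Otimes>\<^sub>M S j) (\<lambda>\<omega>. (Y j \<omega>, U j \<omega>))) (A \<times> B)"
    by (simp add: emeasure_distr emeasure_eq_measure ennreal_mult mult.commute)
qed simp

section \<open>The chain, its limit maps and its limit measures\<close>

text \<open>Here \<open>V\<close> stands for X_0 and a, b for p / C, (1 - p) / C. Stationarity is
  encoded in \<open>tails\<close>, which has the same constants at every time t.\<close>

locale heavy_tailed_chain = prob_space M for M :: "'a measure" +
  fixes \<epsilon> :: "int \<Rightarrow> 'a \<Rightarrow> 's::{metric_space, second_countable_topology}"
    and Y :: "int \<Rightarrow> 'a \<Rightarrow> real" and V :: "'a \<Rightarrow> real" and s :: nat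
    and \<Phi> :: "real \<Rightarrow> 's \<Rightarrow> real" and \<Psi> :: "real \<Rightarrow> (nat \<Rightarrow> 's) \<Rightarrow> real"
    and \<phi> :: "'s \<Rightarrow> real \<Rightarrow> real" and \<psi> :: "(nat \<Rightarrow> 's) \<Rightarrow> real \<Rightarrow> real"
    and \<alpha> a b :: real
  assumes Y [measurable]: "\<And>t. Y t \<in> borel_measurable M"
    and V [measurable]: "V \<in> borel_measurable M"
    and \<epsilon> [measurable]: "\<And>t. \<epsilon> t \<in> borel_measurable M"
    and \<Phi> [measurable]: "case_prod \<Phi> \<in> borel_measurable (borel \<Otimes>\<^sub>M borel)"
    and \<Psi> [measurable]: "case_prod \<Psi> \<in> borel_measurable (borel \<Otimes>\<^sub>M power_borel {1..s})"
    and indep: "innovations_indep_past M \<epsilon> Y"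
    and Y_rec: "\<And>t. AE \<omega> in M. Y t \<omega> = \<Phi> (Y (t - 1) \<omega>) (\<epsilon> t \<omega>)"
    and V_eq: "AE \<omega> in M. V \<omega> = \<Psi> (Y 0 \<omega>) (\<lambda>i\<in>{1..s}. \<epsilon> (int i) \<omega>)"
    and tails: "\<And>t. regularly_varying_tails M (Y t) (\<lambda>x. prob {\<omega> \<in> space M. \<bar>V \<omega>\<bar> > x}) \<alpha> a b"
    and \<Phi>_limit: "scaling_limit euclidean \<Phi> \<phi>"
    and \<Psi>_limit: "scaling_limit (power_top {1..s}) \<Psi> \<psi>"
begin

text \<open>Seen from time \<open>j \<le> 0\<close>, with \<open>w = Y j / x\<close> and innovations \<open>u\<close>, \<open>observe x j u w\<close> is \<open>V / x\<close>;
  windows and paths are extended by zero outside \<open>{j..n}\<close>, so that all of them live in the Polish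
  space \<open>int \<Rightarrow> real\<close>.\<close>

definition "q x = prob {\<omega> \<in> space M. \<bar>V \<omega>\<bar> > x}"
definition "step x w v = \<Phi> (x * w) v / x"
definition "step_limit w v = w * \<phi> v (sign_pm w)"
definition "observe x j u w = \<Psi> (x * orbit (step x) j u w (nat (- j))) (\<lambda>i\<in>{1..s}. u (int i)) / x"
definition "observe_limit j u w = orbit step_limit j u w (nat (- j))
  * \<psi> (\<lambda>i\<in>{1..s}. u (int i)) (sign_pm (orbit step_limit j u w (nat (- j))))"
definition path :: "(real \<Rightarrow> 's \<Rightarrow> real) \<Rightarrow> int \<Rightarrow> int \<Rightarrow> (int \<Rightarrow> 's) \<Rightarrow> real \<Rightarrow> int \<Rightarrow> real" where
  "path F j n u w = (\<lambda>t. if j \<le> t \<and> t \<le> n then orbit F j u w (nat (t - j)) else 0)"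
definition window :: "int \<Rightarrow> int \<Rightarrow> real \<Rightarrow> 'a \<Rightarrow> int \<Rightarrow> real" where
  "window j n x \<omega> = (\<lambda>t. if j \<le> t \<and> t \<le> n then Y t \<omega> / x else 0)"
definition "innovations j = (\<Pi>\<^sub>M t\<in>{j<..}. (borel :: 's measure))"
definition "future j \<omega> = (\<lambda>t\<in>{j<..}. \<epsilon> t \<omega>)"
definition "window_law j n x = law_given_exceedance M borel (window j n x) V x"
text \<open>The law of the limiting path on the limiting exceedance event, under an infinite measure
  for the starting value; a bound on its mass has to be proved. The clause
  \<open>w \<noteq> 0\<close> makes coordinate j nonzero by construction.\<close>

definition "limit_measure j n =
  distr (density (tail_measure \<alpha> a b \<Otimes>\<^sub>M distr M (innovations j) (future j))
      (\<lambda>p. ennreal (indicat_real {(w, u). w \<noteq> 0 \<and> 1 < \<bar>observe_limit j u w\<bar>} p)))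
    borel (\<lambda>(w, u). path step_limit j n u w)"

lemma q_pos: "q x > 0"
  unfolding q_def by (rule regularly_varying_tails.q[OF tails])

lemma measurable_step [measurable]: "case_prod (step x) \<in> borel_measurable (borel \<Otimes>\<^sub>M borel)"
  unfolding step_def by measurable

lemma measurable_step_limit [measurable]: "case_prod step_limit \<in> borel_measurable (borel \<Otimes>\<^sub>M borel)"
  unfolding step_limit_def by (rule borel_measurable_scaling_limit[OF \<Phi> \<Phi>_limit]) simp

lemma filterlim_step: "((\<lambda>(x, w). step x w v) \<longlongrightarrow> step_limit w v) (at_top \<times>\<^sub>F nhds w)"
  unfolding step_def step_limit_def by (rule filterlim_if_scaling_limit[OF \<Phi>_limit]) simp

lemma measurable_future [measurable]: "future j \<in> measurable M (innovations j)"
  unfolding future_def innovations_def by measurable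

lemma measurable_orbit [measurable]:
  "(\<lambda>(w, u). orbit (step x) j u w i) \<in> borel_measurable (borel \<Otimes>\<^sub>M innovations j)"
  "(\<lambda>(w, u). orbit step_limit j u w i) \<in> borel_measurable (borel \<Otimes>\<^sub>M innovations j)"
  unfolding innovations_def by (intro borel_measurable_orbit measurable_step measurable_step_limit)+

lemma measurable_path [measurable]:
  "(\<lambda>(w, u). path (step x) j n u w) \<in> borel_measurable (borel \<Otimes>\<^sub>M innovations j)"
  "(\<lambda>(w, u). path step_limit j n u w) \<in> borel_measurable (borel \<Otimes>\<^sub>M innovations j)"
  unfolding path_def case_prod_unfold
  by (intro measurable_coordinatewise_then_product; measurable)+

lemma measurable_window [measurable]: "window j n x \<in> borel_measurable M"
  unfolding window_def by (intro measurable_coordinatewise_then_product) measurable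

lemma measurable_first_innovations:
  assumes "j \<le> 0"
  shows "(\<lambda>u. \<lambda>i\<in>{1..s}. u (int i)) \<in> measurable (innovations j) (power_borel {1..s})"
  unfolding innovations_def using assms
  by (intro measurable_restrict measurable_component_singleton) auto

lemma measurable_observe:
  assumes "j \<le> 0"
  shows "(\<lambda>(w, u). observe x j u w) \<in> borel_measurable (borel \<Otimes>\<^sub>M innovations j)"
    and "(\<lambda>(w, u). observe_limit j u w) \<in> borel_measurable (borel \<Otimes>\<^sub>M innovations j)"
proof -
  note [measurable] = measurable_first_innovations[OF assms]
  show "(\<lambda>(w, u). observe x j u w) \<in> borel_measurable (borel \<Otimes>\<^sub>M innovations j)"
    unfolding observe_def by measurable
  \<comment> \<open>Measurability is known for this product rather than for \<open>\<psi>\<close>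
    alone, so \<open>observe_limit\<close> is written as a composition with the product.\<close>
  have [measurable]: "(\<lambda>(w, v). w * \<psi> v (sign_pm w)) \<in> borel_measurable
      (borel \<Otimes>\<^sub>M power_borel {1..s})"
    by (rule borel_measurable_scaling_limit[OF \<Psi> \<Psi>_limit]) (simp add: space_PiM)
  have "(\<lambda>(w, u). (\<lambda>(w, v). w * \<psi> v (sign_pm w)) (orbit step_limit j u w (nat (- j)),
      \<lambda>i\<in>{1..s}. u (int i)))
      \<in> borel_measurable (borel \<Otimes>\<^sub>M innovations j)"
    by measurable
  then show "(\<lambda>(w, u). observe_limit j u w) \<in> borel_measurable (borel \<Otimes>\<^sub>M innovations j)"
    by (simp add: observe_limit_def)
qed

lemma filterlim_observe:
  "((\<lambda>(x, w). observe x j u w) \<longlongrightarrow> observe_limit j u w) (at_top \<times>\<^sub>F nhds w)"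
proof -
  let ?o = "\<lambda>p. (\<lambda>(x, w). orbit (step x) j u w (nat (- j))) p"
  have "filterlim (\<lambda>p. (fst p, ?o p))
      (at_top \<times>\<^sub>F nhds (orbit step_limit j u w (nat (- j)))) (at_top \<times>\<^sub>F nhds w)"
    by (rule filterlim_Pair[OF filterlim_fst filterlim_orbit[OF filterlim_step]])
  from filterlim_compose[OF filterlim_if_scaling_limit[OF \<Psi>_limit] this, of "\<lambda>i\<in>{1..s}. u (int i)"]
  show ?thesis by (simp add: case_prod_unfold observe_def observe_limit_def)
qed

lemma filterlim_path:
  "((\<lambda>(x, w). path (step x) j n u w) \<longlongrightarrow> path step_limit j n u w) (at_top \<times>\<^sub>F nhds w)"
proof -
  have "((\<lambda>p. (\<lambda>(x, w). path (step x) j n u w) p t)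
      \<longlongrightarrow> path step_limit j n u w t) (at_top \<times>\<^sub>F nhds w)" for t
    using filterlim_orbit[OF filterlim_step, where j=j and u=u and w=w and i="nat (t - j)"]
    by (auto simp: path_def case_prod_unfold)
  then have "limitin (product_topology (\<lambda>_. euclidean) UNIV) (\<lambda>(x, w). path (step x) j n u w)
      (path step_limit j n u w) (at_top \<times>\<^sub>F nhds w)"
    unfolding limitin_componentwise by simp
  then show ?thesis
    unfolding euclidean_product_topology limitin_canonical_iff .
qed

lemma step_limit_scale: "c > 0 \<Longrightarrow> step_limit (c * w) v = c * step_limit w v"
  by (auto simp: step_limit_def sign_pm_def zero_le_mult_iff)

lemma observe_limit_scale:
  assumes "c > 0"
  shows "observe_limit j u (c * w) = c * observe_limit j u w"
proof -
  have "sign_pm (c * y) = sign_pm y" for y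
    using assms by (auto simp: sign_pm_def zero_le_mult_iff)
  then show ?thesis
    by (simp add: observe_limit_def orbit_homogeneous[where F=step_limit
        and c=c, OF step_limit_scale[OF assms]])
qed

text \<open>By homogeneity the limiting observation has modulus one at no more than one point on each
  side of the origin.\<close>

lemma AE_observe_limit: "AE w in lborel. \<bar>observe_limit j u w\<bar> \<noteq> 1"
proof -
  \<comment> \<open>If a denominator vanishes, the corresponding point is zero by convention; by
    homogeneity the observation is then zero on that whole half-line, so no further point is
    required.\<close>
  let ?S = "{0, 1 / \<bar>observe_limit j u 1\<bar>, - (1 / \<bar>observe_limit j u (- 1)\<bar>)}"
  have S: "w \<in> ?S" if w: "\<bar>observe_limit j u w\<bar> = 1" for w
  proof -
    consider "w = 0" | "w > 0" | "w < 0" by linarith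
    then show ?thesis
    proof cases
      case 2
      then have "w * \<bar>observe_limit j u 1\<bar> = 1"
        using w observe_limit_scale[of w j u 1] by (simp add: abs_mult)
      then have "w = 1 / \<bar>observe_limit j u 1\<bar>"
        by (metis mult_zero_right nonzero_eq_divide_eq zero_neq_one)
      then show ?thesis by simp
    next
      case 3
      then have "- w * \<bar>observe_limit j u (- 1)\<bar> = 1"
        using w observe_limit_scale[of "- w" j u "- 1"] by (simp add: abs_mult)
      then have "- w = 1 / \<bar>observe_limit j u (- 1)\<bar>"
        by (metis mult_zero_right nonzero_eq_divide_eq zero_neq_one)
      then have "w = - (1 / \<bar>observe_limit j u (- 1)\<bar>)" by linarith
      then show ?thesis by simp
    qed simp
  qed
  have "AE w in lborel. w \<notin> ?S"
    by (intro AE_not_in finite_imp_null_set_lborel) simp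
  then show ?thesis
    by (rule eventually_mono) (use S in blast)
qed

text \<open>The map \<open>step x\<close> is \<open>\<Phi>\<close> conjugated by multiplication with
  x, so its orbits are rescaled paths of the chain. A single null set serves all times because they
  are countable.\<close>

lemma AE_window_eq_path:
  assumes x: "x > 0" and j: "j \<le> 0"
  shows "AE \<omega> in M. window j n x \<omega> = path (step x) j n (future j \<omega>) (Y j \<omega> / x) \<and>
    V \<omega> / x = observe x j (future j \<omega>) (Y j \<omega> / x)"
proof -
  have "AE \<omega> in M. \<forall>t. Y t \<omega> = \<Phi> (Y (t - 1) \<omega>) (\<epsilon> t \<omega>)"
    using Y_rec by (simp add: AE_all_countable)
  then show ?thesis
    using V_eq
  proof eventually_elim
    case (elim \<omega>)
    have *: "orbit (step x) j (future j \<omega>) (Y j \<omega> / x) i = Y (j + int i) \<omega> / x" for i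
    proof (induction i)
      case (Suc i)
      have "Y (j + int (Suc i)) \<omega> = \<Phi> (Y (j + int i) \<omega>) (\<epsilon> (j + 1 + int i) \<omega>)"
        using elim(1)[rule_format, of "j + 1 + int i"] by (simp add: add.commute add.left_commute)
      then show ?case using Suc x by (simp add: step_def future_def)
    qed simp
    \<comment> \<open>As j \<le> 0, the times 1, ..., s lie after j and their innovations belong to
      the future.\<close>
    have restr: "(\<lambda>i\<in>{1..s}. future j \<omega> (int i)) = (\<lambda>i\<in>{1..s}. \<epsilon> (int i) \<omega>)"
      using j by (auto simp: future_def fun_eq_iff)
    have "V \<omega> / x = observe x j (future j \<omega>) (Y j \<omega> / x)"
      unfolding observe_def restr * elim(2) using x j by simp
    then show ?case
      by (auto simp: window_def path_def * fun_eq_iff)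
  qed
qed

lemma measurable_limit_event:
  assumes "j \<le> 0"
  shows "indicat_real {(w, u). w \<noteq> 0 \<and> 1 < \<bar>observe_limit j u w\<bar>}
    \<in> borel_measurable (borel \<Otimes>\<^sub>M innovations j)" (is "indicat_real ?B \<in> _")
proof -
  note [measurable] = measurable_observe(2)[OF assms]
  have "(\<lambda>p. if fst p \<noteq> 0 \<and> 1 < \<bar>(\<lambda>(w, u). observe_limit j u w) p\<bar> then 1 else 0 :: real)
      \<in> borel_measurable (borel \<Otimes>\<^sub>M innovations j)"
    by measurable
  also have "(\<lambda>p. if fst p \<noteq> 0 \<and> 1 < \<bar>(\<lambda>(w, u). observe_limit j u w) p\<bar> then 1 else 0 :: real)
      = indicat_real ?B"
    by (auto simp: indicator_def fun_eq_iff)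
  finally show ?thesis .
qed

lemma prob_space_window_law: "prob_space (window_law j n x)"
proof -
  have "prob_space (uniform_measure M {\<omega> \<in> space M. \<bar>V \<omega>\<bar> > x})"
    using q_pos[of x] by (intro prob_space_uniform_measure) (auto simp: q_def emeasure_eq_measure)
  then show ?thesis
    unfolding window_law_def law_given_exceedance_def
    by (rule prob_space.prob_space_distr) simp
qed

lemma integral_law_given_exceedance:
  fixes f :: "'b \<Rightarrow> real"
  assumes "Z \<in> measurable M S" "f \<in> borel_measurable S"
  shows "integral\<^sup>L (law_given_exceedance M S Z V x) f
    = (\<integral>\<omega>. indicat_real {\<omega> \<in> space M. \<bar>V \<omega>\<bar> > x} \<omega> * f (Z \<omega>) \<partial>M) / q x"
proof -
  have [measurable]: "Z \<in> measurable (uniform_measure M {\<omega> \<in> space M. \<bar>V \<omega>\<bar> > x}) S"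
    using assms(1) by (simp cong: measurable_cong_sets)
  have "integral\<^sup>L (law_given_exceedance M S Z V x) f
      = (\<integral>\<omega>. f (Z \<omega>) \<partial>uniform_measure M {\<omega> \<in> space M. \<bar>V \<omega>\<bar> > x})"
    unfolding law_given_exceedance_def using assms by (intro integral_distr) simp_all
  also have "\<dots> = (\<integral>\<omega>. indicat_real {\<omega> \<in> space M. \<bar>V \<omega>\<bar> > x} \<omega> * f (Z \<omega>) \<partial>M) / q x"
    unfolding q_def using assms q_pos[of x]
    by (intro integral_uniform_measure)
        (auto simp: q_def emeasure_eq_measure intro: measurable_compose)
  finally show ?thesis .
qed

text \<open>Window and exceedance event are both functions of the starting value and of the
  independent future, so this is an instance of \<open>limit_above_indep\<close>. The test function
  is continuous and the event has a null boundary in w for each future.\<close>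

lemma tendsto_integral_window_above:
  fixes f :: "(int \<Rightarrow> real) \<Rightarrow> real"
  assumes \<eta>: "\<eta> > 0" and j: "j \<le> 0" "j \<le> n"
    and f: "continuous_on UNIV f" "bounded (range f)"
  shows "((\<lambda>x. \<integral>y. indicat_real {y. \<eta> < \<bar>y j\<bar>} y * f y \<partial>window_law j n x)
    \<longlongrightarrow> (\<integral>y. indicat_real {y. \<eta> < \<bar>y j\<bar>} y * f y \<partial>limit_measure j n)) at_top"
proof -
  interpret regularly_varying_tails M "Y j" q \<alpha> a b
    unfolding q_def by (rule tails)
  note [measurable] = measurable_observe[OF j(1)]
  have [measurable]: "(\<lambda>y. y j) \<in> borel_measurable (borel :: (int \<Rightarrow> real) measure)"
    by (rule measurable_coordinate)
  have [measurable]: "f \<in> borel_measurable borel"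
    using f(1) by (rule borel_measurable_continuous_onI)
  obtain K where K: "\<And>y. \<bar>f y\<bar> \<le> K"
    using f(2) by (auto simp: bounded_iff)
  have "K \<ge> 0" using K[of undefined] by linarith
  \<comment> \<open>In the rescaled variables |V| > x reads |observe| > 1, a condition with a fixed
    threshold.\<close>
  define h where "h x w u = indicat_real {y. 1 < \<bar>y\<bar>} (observe x j u w) * f (path (step x) j n u w)"
      for x w u
  define h' where "h' w u = indicat_real {y. 1 < \<bar>y\<bar>} (observe_limit j u w) * f
      (path step_limit j n u w)" for w u
  have lim: "((\<lambda>x. (\<integral>\<omega>. indicat_real {w. \<eta> < \<bar>w\<bar>} (Y j \<omega> / x) * h x (Y j \<omega> / x)
      (future j \<omega>) \<partial>M) / q x)
    \<longlongrightarrow> (\<integral>(w, u). indicat_real {w. \<eta> < \<bar>w\<bar>} w * h' w u \<partial>(\<rho> \<Otimes>\<^sub>M distr M (innovations j)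
        (future j)))) at_top"
  proof (rule limit_above_indep[OF \<eta> measurable_future])
    show "distr M (borel \<Otimes>\<^sub>M innovations j) (\<lambda>\<omega>. (Y j \<omega>, future j \<omega>))
        = distr M borel (Y j) \<Otimes>\<^sub>M distr M (innovations j) (future j)"
      using joint_law_innovations_past[OF indep \<epsilon> Y, of j]
          by (simp add: innovations_def future_def[abs_def])
    show "case_prod (h x) \<in> borel_measurable (borel \<Otimes>\<^sub>M innovations j)" for x
      unfolding h_def by measurable
    show "case_prod h' \<in> borel_measurable (borel \<Otimes>\<^sub>M innovations j)"
      unfolding h'_def by measurable
    show "\<bar>h x w u\<bar> \<le> K" "\<bar>h' w u\<bar> \<le> K" for x w u
      using K \<open>K \<ge> 0\<close> by (auto simp: h_def h'_def indicator_def)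
    show "AE w in lborel. ((\<lambda>(x, v). h x v u) \<longlongrightarrow> h' w u) (at_top \<times>\<^sub>F nhds w)" for u
      using AE_observe_limit[of j u]
    proof eventually_elim
      case (elim w)
      have "((\<lambda>p. f ((\<lambda>(x, w). path (step x) j n u w) p))
          \<longlongrightarrow> f (path step_limit j n u w)) (at_top \<times>\<^sub>F nhds w)"
        by (rule tendsto_compose[OF _ filterlim_path])
          (use f(1) in \<open>simp add: continuous_on_eq_continuous_at isCont_def\<close>)
      \<comment> \<open>Off modulus one the indicator is locally constant, so it eventually equals
        its limit.\<close>
      moreover have "((\<lambda>p. indicat_real {y. 1 < \<bar>y\<bar>} ((\<lambda>(x, w). observe x j u w) p))
          \<longlongrightarrow> indicat_real {y. 1 < \<bar>y\<bar>} (observe_limit j u w)) (at_top \<times>\<^sub>F nhds w)"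
      proof (rule tendsto_eventually)
        have lo: "((\<lambda>p. \<bar>(\<lambda>(x, w). observe x j u w) p\<bar>) \<longlongrightarrow> \<bar>observe_limit j u w\<bar>) (at_top \<times>\<^sub>F nhds w)"
          by (intro tendsto_rabs filterlim_observe)
        show "\<forall>\<^sub>F p in at_top \<times>\<^sub>F nhds w. indicat_real {y. 1 < \<bar>y\<bar>} ((\<lambda>(x, w). observe x j u w) p)
            = indicat_real {y. 1 < \<bar>y\<bar>} (observe_limit j u w)"
        proof (cases "1 < \<bar>observe_limit j u w\<bar>")
          case True
          from order_tendstoD(1)[OF lo True] show ?thesis
            by eventually_elim (use True in simp)
        next
          case False
          then have less: "\<bar>observe_limit j u w\<bar> < 1" using elim by linarith
          from order_tendstoD(2)[OF lo less] show ?thesis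
            by eventually_elim (use less in simp)
        qed
      qed
      ultimately show ?case
        unfolding h_def h'_def case_prod_unfold by (rule tendsto_mult[rotated])
    qed
  qed
  have left: "\<forall>\<^sub>F x in at_top. (\<integral>\<omega>. indicat_real {w. \<eta> < \<bar>w\<bar>} (Y j \<omega> / x) * h x (Y j \<omega> / x)
      (future j \<omega>) \<partial>M) / q x
      = (\<integral>y. indicat_real {y. \<eta> < \<bar>y j\<bar>} y * f y \<partial>window_law j n x)"
    using eventually_gt_at_top[of 0]
  proof eventually_elim
    case (elim x)
    have "(\<integral>y. indicat_real {y. \<eta> < \<bar>y j\<bar>} y * f y \<partial>window_law j n x)
        = (\<integral>\<omega>. indicat_real {\<omega> \<in> space M. \<bar>V \<omega>\<bar> > x} \<omega>
            * (indicat_real {y. \<eta> < \<bar>y j\<bar>} (window j n x \<omega>) * f (window j n x \<omega>)) \<partial>M) / q x"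
      unfolding window_law_def by (intro integral_law_given_exceedance) measurable
    also have "(\<integral>\<omega>. indicat_real {\<omega> \<in> space M. \<bar>V \<omega>\<bar> > x} \<omega>
            * (indicat_real {y. \<eta> < \<bar>y j\<bar>} (window j n x \<omega>) * f (window j n x \<omega>)) \<partial>M)
        = (\<integral>\<omega>. indicat_real {w. \<eta> < \<bar>w\<bar>} (Y j \<omega> / x) * h x (Y j \<omega> / x) (future j \<omega>) \<partial>M)"
    proof (rule integral_cong_AE)
      show "AE \<omega> in M. indicat_real {\<omega> \<in> space M. \<bar>V \<omega>\<bar> > x} \<omega>
            * (indicat_real {y. \<eta> < \<bar>y j\<bar>} (window j n x \<omega>) * f (window j n x \<omega>))
          = indicat_real {w. \<eta> < \<bar>w\<bar>} (Y j \<omega> / x) * h x (Y j \<omega> / x) (future j \<omega>)"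
        using AE_window_eq_path[OF elim j(1), of n] AE_space
      proof eventually_elim
        case (elim \<omega>)
        have "window j n x \<omega> j = Y j \<omega> / x" using j by (simp add: window_def)
        moreover have "x < \<bar>V \<omega>\<bar> \<longleftrightarrow> 1 < \<bar>V \<omega> / x\<bar>" using \<open>0 < x\<close> by simp
        ultimately show ?case
          using elim by (auto simp: h_def indicator_def)
      qed
      show "(\<lambda>\<omega>. indicat_real {w. \<eta> < \<bar>w\<bar>} (Y j \<omega> / x) * h x (Y j \<omega> / x)
          (future j \<omega>)) \<in> borel_measurable M"
        unfolding h_def by measurable
    qed measurable
    finally show ?case by simp
  qed
  define P where "P = \<rho> \<Otimes>\<^sub>M distr M (innovations j) (future j)"
  have sets_P [measurable_cong]: "sets P = sets (borel \<Otimes>\<^sub>M innovations j)"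
    unfolding P_def by (intro sets_pair_measure_cong) simp_all
  define B where "B = {(w, u). w \<noteq> 0 \<and> 1 < \<bar>observe_limit j u w\<bar>}"
  have B: "indicat_real B \<in> borel_measurable P"
    unfolding B_def measurable_cong_sets[OF sets_P refl] by (rule measurable_limit_event[OF j(1)])
  have F: "(\<lambda>y. indicat_real {y. \<eta> < \<bar>y j\<bar>} y * f y) \<in> borel_measurable borel"
    by measurable
  have \<pi>: "(\<lambda>(w, u). path step_limit j n u w) \<in> borel_measurable P"
    by measurable
  have \<pi>': "(\<lambda>(w, u). path step_limit j n u w) \<in> borel_measurable (density P (\<lambda>p. ennreal
      (indicat_real B p)))"
    using \<pi> by simp
  have "(\<integral>y. indicat_real {y. \<eta> < \<bar>y j\<bar>} y * f y \<partial>limit_measure j n)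
    = (\<integral>p. indicat_real {y. \<eta> < \<bar>y j\<bar>} ((\<lambda>(w, u). path step_limit j n u w) p) * f
        ((\<lambda>(w, u). path step_limit j n u w) p)
        \<partial>density P (\<lambda>p. ennreal (indicat_real B p)))"
    unfolding limit_measure_def P_def[symmetric] B_def[symmetric] by (rule integral_distr[OF \<pi>' F])
  also have "\<dots> = (\<integral>p. indicat_real B p *\<^sub>R
      (indicat_real {y. \<eta> < \<bar>y j\<bar>} ((\<lambda>(w, u). path step_limit j n u w) p) * f
          ((\<lambda>(w, u). path step_limit j n u w) p)) \<partial>P)"
    by (rule integral_density[OF measurable_compose[OF \<pi> F] B]) simp
  \<comment> \<open>A path from w has coordinate j equal to w, so the truncation of the window is
    that of w; it implies w \<noteq> 0 since \<eta> > 0.\<close>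
  also have "\<dots> = (\<integral>(w, u). indicat_real {w. \<eta> < \<bar>w\<bar>} w * h' w u \<partial>P)"
    using j \<eta> by (intro Bochner_Integration.integral_cong)
        (auto simp: B_def h'_def path_def indicator_def)
  finally show ?thesis
    using Lim_transform_eventually[OF lim left] by (simp add: P_def)
qed

section \<open>Limits of the conditional laws\<close>

declare measurable_coordinate [measurable]

lemma sets_limit_measure [simp]: "sets (limit_measure j n) = sets borel"
  by (simp add: limit_measure_def)

lemma sets_window_law [simp]: "sets (window_law j n x) = sets borel"
  by (simp add: window_law_def law_given_exceedance_def)

text \<open>Above each \<eta> the mass is a limit of conditional probabilities, hence at most one;
  since coordinate j is almost never zero, letting \<eta> decrease to zero exhausts the
  measure.\<close>

lemma limit_measure_le_1:
  assumes j: "j \<le> 0" "j \<le> n"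
  shows "AE y in limit_measure j n. y j \<noteq> 0" "emeasure (limit_measure j n) UNIV \<le> 1"
proof -
  interpret regularly_varying_tails M "Y j" q \<alpha> a b
    unfolding q_def by (rule tails)
  interpret Q: prob_space "distr M (innovations j) (future j)"
    by (rule prob_space_distr) simp
  define P where "P = \<rho> \<Otimes>\<^sub>M distr M (innovations j) (future j)"
  have sets_P [measurable_cong]: "sets P = sets (borel \<Otimes>\<^sub>M innovations j)"
    unfolding P_def by (intro sets_pair_measure_cong) simp_all
  define B where "B = {(w, u). w \<noteq> 0 \<and> 1 < \<bar>observe_limit j u w\<bar>}"
  have B: "indicat_real B \<in> borel_measurable P"
    unfolding B_def measurable_cong_sets[OF sets_P refl] by (rule measurable_limit_event[OF j(1)])
  define \<pi> where "\<pi> = (\<lambda>(w, u). path step_limit j n u w)"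
  have \<pi>: "\<pi> \<in> borel_measurable P"
    unfolding \<pi>_def by measurable
  have \<pi>j: "\<pi> (w, u) j = w" for w u using j by (simp add: \<pi>_def path_def)
  define D where "D = density P (\<lambda>p. ennreal (indicat_real B p))"
  have \<pi>D [measurable]: "\<pi> \<in> borel_measurable D" using \<pi> by (simp add: D_def)
  define A where "A = distr D borel \<pi>"
  have A: "limit_measure j n = A"
    by (simp add: limit_measure_def A_def D_def P_def B_def \<pi>_def)
  have "\<pi> p j \<noteq> 0" if "0 < ennreal (indicat_real B p)" for p
  proof -
    have "p \<in> B" using that by (simp add: indicator_def split: if_splits)
    then show ?thesis by (cases p) (simp add: B_def \<pi>j)
  qed
  then have "AE p in D. \<pi> p j \<noteq> 0"
    unfolding D_def using measurable_compose[OF B measurable_ennreal] by (simp add: AE_density)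
  then have nz: "AE y in A. y j \<noteq> 0"
    unfolding A_def by (subst AE_distr_iff) auto
  then show "AE y in limit_measure j n. y j \<noteq> 0" unfolding A .
  \<comment> \<open>Finiteness comes first: \<open>measure\<close> is zero on sets of infinite mass,
    so a bound on it alone would give no bound on \<open>emeasure\<close>.\<close>
  have above: "emeasure A {y. \<eta> < \<bar>y j\<bar>} \<le> 1" if \<eta>: "\<eta> > 0" for \<eta>
  proof -
    have "emeasure A {y. \<eta> < \<bar>y j\<bar>} = emeasure D (\<pi> -` {y. \<eta> < \<bar>y j\<bar>} \<inter> space D)"
      unfolding A_def by (intro emeasure_distr) measurable
    also have "\<dots> = (\<integral>\<^sup>+p. ennreal (indicat_real B p) * indicator
        (\<pi> -` {y. \<eta> < \<bar>y j\<bar>} \<inter> space D) p \<partial>P)"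
    proof -
      have "\<pi> -` {y. \<eta> < \<bar>y j\<bar>} \<inter> space D \<in> sets D" by measurable
      then show ?thesis
        using B unfolding D_def by (intro emeasure_density) auto
    qed
    also have "\<dots> \<le> (\<integral>\<^sup>+p. indicator ({w. \<eta> < \<bar>w\<bar>} \<times> space (innovations j)) p \<partial>P)"
      by (intro nn_integral_mono) (auto simp: indicator_def \<pi>j D_def P_def space_pair_measure)
    also have "\<dots> = emeasure \<rho> {w. \<eta> < \<bar>w\<bar>} * emeasure (distr M (innovations j) (future j)) (space
        (innovations j))"
      unfolding P_def by (subst nn_integral_indicator) (auto intro!: Q.emeasure_pair_measure_Times)
    also have "\<dots> < \<infinity>"
      using measure_tail_measure(3)[OF \<alpha> ab(1,2) \<eta>] Q.emeasure_space_1 by simp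
    finally have fin: "emeasure A {y. \<eta> < \<bar>y j\<bar>} < \<infinity>" .
    have lim: "((\<lambda>x. \<integral>y. indicat_real {y. \<eta> < \<bar>y j\<bar>} y \<partial>window_law j n x)
        \<longlongrightarrow> (\<integral>y. indicat_real {y. \<eta> < \<bar>y j\<bar>} y \<partial>A)) at_top"
      using tendsto_integral_window_above[OF \<eta> j, of "\<lambda>_. 1"] by (simp add: A)
    have "(\<integral>y. indicat_real {y. \<eta> < \<bar>y j\<bar>} y \<partial>A) \<le> 1"
    proof (rule tendsto_upperbound[OF lim])
      show "\<forall>\<^sub>F x in at_top. (\<integral>y. indicat_real {y. \<eta> < \<bar>y j\<bar>} y \<partial>window_law j n x) \<le> 1"
        using prob_space.prob_le_1[OF prob_space_window_law]
        by (intro always_eventually) (simp add: sets_eq_imp_space_eq[of _ borel])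
    qed simp
    then have "measure A {y. \<eta> < \<bar>y j\<bar>} \<le> 1"
      by (simp add: A_def)
    then show ?thesis
      using fin by (simp add: emeasure_eq_ennreal_measure less_top)
  qed
  define \<eta> where "\<eta> k = inverse (real (Suc k))" for k
  have \<eta>: "\<eta> k > 0" for k by (simp add: \<eta>_def)
  have m: "{y. \<eta> k < \<bar>y j\<bar>} \<in> sets A" for k
    unfolding A_def by simp measurable
  have "emeasure A UNIV = emeasure A (\<Union>k. {y. \<eta> k < \<bar>y j\<bar>})"
  proof (rule emeasure_eq_AE)
    show "AE y in A. (y \<in> UNIV) = (y \<in> (\<Union>k. {y. \<eta> k < \<bar>y j\<bar>}))"
      using nz
    proof eventually_elim
      case (elim y)
      then obtain k where "inverse (real (Suc k)) < \<bar>y j\<bar>"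
        using reals_Archimedean[of "\<bar>y j\<bar>"] by auto
      then show ?case by (auto simp: \<eta>_def)
    qed
  qed (use m in \<open>auto simp: A_def\<close>)
  also have "\<dots> = (SUP k. emeasure A {y. \<eta> k < \<bar>y j\<bar>})"
  proof (rule SUP_emeasure_incseq[symmetric])
    have "\<eta> (Suc k) \<le> \<eta> k" for k by (simp add: \<eta>_def)
    then show "incseq (\<lambda>k. {y. \<eta> k < \<bar>y j\<bar>})"
      by (intro incseq_SucI) (auto intro: le_less_trans)
  qed (use m in auto)
  also have "\<dots> \<le> 1"
    by (intro SUP_least above \<eta>)
  finally show "emeasure (limit_measure j n) UNIV \<le> 1" by (simp add: A)
qed

lemma finite_limit_measure: "j \<le> 0 \<Longrightarrow> j \<le> n \<Longrightarrow> finite_measure (limit_measure j n)"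
  using limit_measure_le_1(2)[of j n]
  by (intro finite_measureI) (auto simp: sets_eq_imp_space_eq[of _ borel] top_unique)


text \<open>Translates between the zero-padded windows used internally and the laws of the
  statement, with \<open>r\<close> extracting the relevant coordinates.\<close>

lemma integral_window_law:
  fixes g :: "'b \<Rightarrow> real" and r :: "(int \<Rightarrow> real) \<Rightarrow> 'b"
  assumes r: "r \<in> measurable borel S" and g: "g \<in> borel_measurable S"
    and Z: "\<And>\<omega>. \<omega> \<in> space M \<Longrightarrow> r (window j n x \<omega>) = Z \<omega>"
  shows "integral\<^sup>L (window_law j n x) (\<lambda>y. g (r y)) = integral\<^sup>L (law_given_exceedance M S Z V x) g"
proof -
  have "(\<lambda>\<omega>. r (window j n x \<omega>)) \<in> measurable M S"
    using r by measurable
  then have Zm: "Z \<in> measurable M S"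
    using Z by (simp cong: measurable_cong)
  have "integral\<^sup>L (window_law j n x) (\<lambda>y. g (r y))
      = (\<integral>\<omega>. indicat_real {\<omega> \<in> space M. \<bar>V \<omega>\<bar> > x} \<omega> * g (r (window j n x \<omega>)) \<partial>M) / q x"
    unfolding window_law_def by
        (intro integral_law_given_exceedance measurable_window measurable_compose[OF r g])
  also have "(\<integral>\<omega>. indicat_real {\<omega> \<in> space M. \<bar>V \<omega>\<bar> > x} \<omega> * g (r (window j n x \<omega>)) \<partial>M)
      = (\<integral>\<omega>. indicat_real {\<omega> \<in> space M. \<bar>V \<omega>\<bar> > x} \<omega> * g (Z \<omega>) \<partial>M)"
    by (intro Bochner_Integration.integral_cong) (simp_all add: Z)
  also have "\<dots> / q x = integral\<^sup>L (law_given_exceedance M S Z V x) g"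
    using Zm g by (rule integral_law_given_exceedance[symmetric])
  finally show ?thesis .
qed

section \<open>Consequences of an accumulation point without mass at zero\<close>

definition "no_mass_at_zero \<longleftrightarrow>
  (\<exists>\<nu>. weak_accumulation_point euclidean borel (\<lambda>x. law_given_exceedance M borel
      (\<lambda>\<omega>. Y 0 \<omega> / x) V x) \<nu>
    \<and> (AE y in \<nu>. y \<noteq> 0))"

text \<open>Mass lost near zero would be visible in the accumulation point. Continuous functions
  vanishing at zero are dominated by the truncation indicator up to e; their integrals against \<nu>
  tend to one because \<nu> does not charge zero, and the limits of the truncated masses are the
  same along every sequence.\<close>

lemma limit_measure_0_prob:
  assumes n: "0 \<le> n" and "no_mass_at_zero"
  shows "prob_space (limit_measure 0 n)"
proof -
  obtain \<nu> and X :: "nat \<Rightarrow> real" where X: "filterlim X at_top sequentially"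
    and wl: "weak_limit euclidean borel (\<lambda>k. law_given_exceedance M borel (\<lambda>\<omega>. Y 0 \<omega> / X k) V
        (X k)) \<nu> sequentially"
    and nz: "AE y in \<nu>. y \<noteq> 0"
    using assms(2) unfolding no_mass_at_zero_def weak_accumulation_point_def by blast
  have \<nu>: "prob_space \<nu>" "sets \<nu> = sets borel"
    using wl by (auto simp: weak_limit_def)
  interpret \<nu>: prob_space \<nu> by (rule \<nu>)
  note [measurable_cong] = \<nu>(2)
  interpret A: finite_measure "limit_measure 0 n"
    using n by (intro finite_limit_measure) auto
  \<comment> \<open>A continuous substitute for the indicator of y \<noteq> 0, to which it increases
    as d decreases to zero.\<close>
  define g where "g d y = min 1 (\<bar>y\<bar> / d)" for d y :: real
  have g: "continuous_on UNIV (g d)" "g d \<in> borel_measurable borel" "bounded (range (g d))"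
    "\<And>y. \<bar>g d y\<bar> \<le> 1" "\<And>y. g d y \<ge> 0" if "d > 0" for d
  proof -
    show c: "continuous_on UNIV (g d)" unfolding g_def using that by (intro continuous_intros) auto
    show "g d \<in> borel_measurable borel" using c by (rule borel_measurable_continuous_onI)
    show "\<bar>g d y\<bar> \<le> 1" "g d y \<ge> 0" for y using that by (auto simp: g_def)
    then show "bounded (range (g d))" by (intro boundedI[of _ 1]) auto
  qed
  have low: "measure (limit_measure 0 n) UNIV \<ge> integral\<^sup>L \<nu> (g d) - e"
      if d: "d > 0" and e: "e > 0" for d e
  proof -
    \<comment> \<open>With this choice |y| \<le> \<eta> gives g d y \<le> e, while g d is at most
      one elsewhere.\<close>
    define \<eta> where "\<eta> = d * e"
    have \<eta>: "\<eta> > 0" using d e by (simp add: \<eta>_def)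
    have "(\<lambda>k. integral\<^sup>L (law_given_exceedance M borel (\<lambda>\<omega>. Y 0 \<omega> / X k) V (X k)) (g d))
        \<longlonglongrightarrow> integral\<^sup>L \<nu> (g d)"
      using wl g[OF d] unfolding weak_limit_def by simp
    moreover have "integral\<^sup>L (law_given_exceedance M borel (\<lambda>\<omega>. Y 0 \<omega> / x) V x) (g d)
        = (\<integral>y. g d (y 0) \<partial>window_law 0 n x)" for x
      using n g[OF d] by (intro integral_window_law[symmetric]) (auto simp: window_def)
    ultimately have l1: "(\<lambda>k. (\<integral>y. g d (y 0) \<partial>window_law 0 n (X k)) - e) \<longlonglongrightarrow> integral\<^sup>L \<nu> (g d) - e"
      by (intro tendsto_intros) simp
    have "((\<lambda>x. \<integral>y. indicat_real {y. \<eta> < \<bar>y 0\<bar>} y \<partial>window_law 0 n x)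
        \<longlongrightarrow> (\<integral>y. indicat_real {y. \<eta> < \<bar>y 0\<bar>} y \<partial>limit_measure 0 n)) at_top"
      using tendsto_integral_window_above[OF \<eta>, of 0 n "\<lambda>_. 1"] n by simp
    from filterlim_compose[OF this X]
    have l2: "(\<lambda>k. \<integral>y. indicat_real {y. \<eta> < \<bar>y 0\<bar>} y \<partial>window_law 0 n (X k))
        \<longlonglongrightarrow> measure (limit_measure 0 n) {y. \<eta> < \<bar>y 0\<bar>}"
      by (simp add: sets_eq_imp_space_eq[of _ borel])
    have "integral\<^sup>L \<nu> (g d) - e \<le> measure (limit_measure 0 n) {y. \<eta> < \<bar>y 0\<bar>}"
    proof (rule LIMSEQ_le[OF l1 l2], intro exI allI impI)
      fix k
      interpret W: prob_space "window_law 0 n (X k)" by (rule prob_space_window_law)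
      note [measurable_cong] = sets_window_law
      have [measurable]: "g d \<in> borel_measurable borel" by (rule g[OF d])
      have I: "integrable (window_law 0 n (X k)) (\<lambda>y. g d (y 0))"
        "integrable (window_law 0 n (X k)) (indicat_real {y. \<eta> < \<bar>y 0\<bar>})"
        using g(4)[OF d] by (auto intro!: W.integrable_const_bound[where B=1] simp: sets_eq_imp_space_eq[of _ borel])
      have "(\<integral>y. g d (y 0) \<partial>window_law 0 n (X k))
          \<le> (\<integral>y. indicat_real {y. \<eta> < \<bar>y 0\<bar>} y + e \<partial>window_law 0 n (X k))"
      proof (rule integral_mono)
        fix y :: "int \<Rightarrow> real"
        show "g d (y 0) \<le> indicat_real {y. \<eta> < \<bar>y 0\<bar>} y + e"
        proof (cases "\<eta> < \<bar>y 0\<bar>")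
          case True
          then show ?thesis using e by (simp add: g_def)
        next
          case False
          then have "\<bar>y 0\<bar> / d \<le> e" using d by (simp add: \<eta>_def field_simps)
          then show ?thesis using False by (simp add: g_def)
        qed
      qed (use I in auto)
      also have "\<dots> = (\<integral>y. indicat_real {y. \<eta> < \<bar>y 0\<bar>} y \<partial>window_law 0 n (X k)) + e"
        using I(2) W.prob_space by (subst Bochner_Integration.integral_add) auto
      finally show "(\<integral>y. g d (y 0) \<partial>window_law 0 n (X k)) - e
          \<le> (\<integral>y. indicat_real {y. \<eta> < \<bar>y 0\<bar>} y \<partial>window_law 0 n (X k))"
        by simp
    qed
    also have "\<dots> \<le> measure (limit_measure 0 n) UNIV"
      by (intro A.finite_measure_mono) (auto simp: sets_eq_imp_space_eq[of _ borel])
    finally show ?thesis .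
  qed
  define \<eta> where "\<eta> k = inverse (real (Suc k))" for k
  have \<eta>: "\<eta> k > 0" for k by (simp add: \<eta>_def)
  have \<eta>0: "\<eta> \<longlonglongrightarrow> 0" unfolding \<eta>_def by (rule LIMSEQ_inverse_real_of_nat)
  have "(\<lambda>k. integral\<^sup>L \<nu> (g (\<eta> k))) \<longlonglongrightarrow> (\<integral>y. 1 \<partial>\<nu>)"
  proof (rule integral_dominated_convergence[where w="\<lambda>_. 1"])
    show "AE y in \<nu>. (\<lambda>k. g (\<eta> k) y) \<longlonglongrightarrow> 1"
      using nz
    proof eventually_elim
      case (elim y)
      have "\<forall>\<^sub>F k in sequentially. \<eta> k < \<bar>y\<bar>"
        using elim \<eta>0 by (intro order_tendstoD(2)[of \<eta> 0]) auto
      then have "\<forall>\<^sub>F k in sequentially. g (\<eta> k) y = 1"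
        by eventually_elim (simp add: g_def \<eta> field_simps)
      then show ?case by (rule tendsto_eventually)
    qed
  qed (use g(2,4)[OF \<eta>] \<nu>(2) in \<open>auto cong: measurable_cong_sets\<close>)
  \<comment> \<open>The bound \<open>low\<close> is used with d and e both equal to \<eta>
    k.\<close>
  from tendsto_diff[OF this \<eta>0]
  have "(\<lambda>k. integral\<^sup>L \<nu> (g (\<eta> k)) - \<eta> k) \<longlonglongrightarrow> 1"
    using \<nu>.prob_space by simp
  then have "1 \<le> measure (limit_measure 0 n) UNIV"
    by (rule LIMSEQ_le_const2) (use low[OF \<eta> \<eta>] in auto)
  then have "1 \<le> emeasure (limit_measure 0 n) UNIV"
    using A.emeasure_eq_measure[of UNIV] by (simp add: ennreal_1[symmetric] del: ennreal_1)
  then have "emeasure (limit_measure 0 n) UNIV = 1"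
    using limit_measure_le_1(2)[of 0 n] n by (intro antisym) auto
  then show ?thesis
    by (intro prob_spaceI) (simp add: sets_eq_imp_space_eq[of _ borel])
qed

lemma weak_limit_window_0:
  assumes n: "0 \<le> n" and "no_mass_at_zero"
  shows "weak_limit euclidean borel (window_law 0 n) (limit_measure 0 n) at_top"
proof (rule weak_limit_if_limits_above[where s="\<lambda>y. y 0"])
  show "prob_space (limit_measure 0 n)"
    using assms by (rule limit_measure_0_prob)
  show "AE y in limit_measure 0 n. y 0 \<noteq> 0"
    using limit_measure_le_1(1)[of 0 n] n by simp
  show "((\<lambda>x. \<integral>y. indicat_real {y. \<eta> < \<bar>y 0\<bar>} y * f y \<partial>window_law 0 n x)
      \<longlongrightarrow> (\<integral>y. indicat_real {y. \<eta> < \<bar>y 0\<bar>} y * f y \<partial>limit_measure 0 n)) at_top"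
    if "\<eta> > 0" "continuous_on UNIV f" "bounded (range f)" for \<eta> and f :: "(int \<Rightarrow> real) \<Rightarrow> real"
    using that n by (intro tendsto_integral_window_above) auto
qed (simp_all add: prob_space_window_law)

text \<open>Induction backwards in time. Setting the oldest coordinate to zero turns the window from
  j into the window from j + 1 exactly, so the induction hypothesis is the convergence of images
  required by the truncation step.\<close>

lemma weak_limit_window:
  assumes n: "0 \<le> n" and "no_mass_at_zero"
  shows "\<exists>L. weak_limit euclidean borel (window_law (- int i) n) L at_top"
proof (induction i)
  case 0
  then show ?case using weak_limit_window_0[OF assms] by auto
next
  case (Suc i)
  define j where "j = - int (Suc i)"
  have j: "j \<le> 0" "j \<le> n" and j1: "- int i = j + 1" using n by (auto simp: j_def)
  obtain L' where L': "weak_limit euclidean borel (window_law (j + 1) n) L' at_top"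
    using Suc j1 by auto
  have z: "continuous_on UNIV (\<lambda>y :: int \<Rightarrow> real. y(j := 0))"
  proof (rule continuous_on_coordinatewise_then_product)
    show "continuous_on UNIV (\<lambda>y :: int \<Rightarrow> real. (y(j := 0)) i)" for i
      by (cases "i = j") (auto intro: continuous_on_product_then_coordinatewise)
  qed
  have zm: "(\<lambda>y :: int \<Rightarrow> real. y(j := 0)) \<in> borel_measurable borel"
    using z by (rule borel_measurable_continuous_onI)
  have "distr (window_law j n x) borel (\<lambda>y. y(j := 0)) = window_law (j + 1) n x" for x
  proof -
    have "(window j n x \<omega>)(j := 0) = window (j + 1) n x \<omega>" for \<omega>
      by (auto simp: window_def)
    then have "(\<lambda>y. y(j := 0)) \<circ> window j n x = window (j + 1) n x"
      by (auto simp: fun_eq_iff)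
    moreover have "window j n x \<in> borel_measurable (uniform_measure M {\<omega> \<in> space M. \<bar>V \<omega>\<bar> > x})"
      by (simp cong: measurable_cong_sets)
    ultimately show ?thesis
      unfolding window_law_def law_given_exceedance_def by (simp add: distr_distr[OF zm])
  qed
  then have Lz: "weak_limit euclidean borel (\<lambda>x. distr (window_law j n x) borel
      (\<lambda>y. y(j := 0))) L' at_top"
    using L' by simp
  have "\<exists>L. weak_limit euclidean borel (window_law j n) L at_top"
  \<comment> \<open>The factor 2 in s comes from the metric of the sequence space: erasing
    coordinate j moves a point by at most 2 |y j|. Truncation of s at \<eta> is truncation of y j at
    \<eta> / 2.\<close>
  proof (rule weak_limit_truncation_step[OF prob_space_window_law sets_window_law
      finite_limit_measure[OF j] sets_limit_measure _ _ z _ _ _ Lz, where s="\<lambda>y. 2 * y j"])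
    show "AE y in limit_measure j n. 2 * y j \<noteq> 0"
      using limit_measure_le_1(1)[OF j] by simp
    show "dist y (y(j := 0)) \<le> \<bar>2 * y j\<bar>" for y :: "int \<Rightarrow> real"
      using dist_fun_upd_le[of y j] by (simp add: abs_mult)
    fix \<eta> :: real and f :: "(int \<Rightarrow> real) \<Rightarrow> real"
    assume "\<eta> > 0" and f: "continuous_on UNIV f" "bounded (range f)"
    then have "\<eta> / 2 > 0" by simp
    from tendsto_integral_window_above[OF this j f]
    show "((\<lambda>x. \<integral>y. indicat_real {y. \<eta> < \<bar>2 * y j\<bar>} y * f y \<partial>window_law j n x)
        \<longlongrightarrow> (\<integral>y. indicat_real {y. \<eta> < \<bar>2 * y j\<bar>} y * f y \<partial>limit_measure j n)) at_top"
      by (simp add: abs_mult mult.commute[of 2] pos_divide_less_eq)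
  qed auto
  then show ?case by (simp only: j_def)
qed


section \<open>From padded windows to the laws in the statement\<close>

lemma weak_limit_coordinates:
  assumes "no_mass_at_zero"
  shows "\<exists>L. weak_limit (power_top {m..n}) (power_borel {m..n})
    (\<lambda>x. law_given_exceedance M (power_borel {m..n}) (\<lambda>\<omega>. \<lambda>t\<in>{m..n}. Y t \<omega> / x) V x) L at_top"
proof -
  \<comment> \<open>The argument needs windows that start at or before 0 and end at or after 0. An
    arbitrary {m..n} is embedded in such a window, and its law is the image under a continuous
    projection.\<close>
  define N where "N = nat \<bar>m\<bar> + nat \<bar>n\<bar>"
  have N: "- int N \<le> t \<and> t \<le> int N" if "t \<in> {m..n}" for t using that by (auto simp: N_def)
  obtain L where L: "weak_limit euclidean borel (window_law (- int N) (int N)) L at_top"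
    using weak_limit_window[OF _ assms, of "int N" N] by auto
  have Lp: "prob_space L" "sets L = sets borel" using L by (auto simp: weak_limit_def)
  have rm: "(\<lambda>y. restrict y {m..n}) \<in> measurable L (power_borel {m..n})"
    using measurable_restrict_coordinates Lp(2) by (simp cong: measurable_cong_sets)
  have "weak_limit (power_top {m..n}) (power_borel {m..n})
    (\<lambda>x. law_given_exceedance M (power_borel {m..n}) (\<lambda>\<omega>. \<lambda>t\<in>{m..n}. Y t \<omega> / x) V x)
    (distr L (power_borel {m..n}) (\<lambda>y. restrict y {m..n})) at_top"
    unfolding weak_limit_def
  proof (intro conjI allI impI)
    show "prob_space (distr L (power_borel {m..n}) (\<lambda>y. restrict y {m..n}))"
      using Lp(1) rm by (rule prob_space.prob_space_distr)
    fix f :: "(int \<Rightarrow> real) \<Rightarrow> real"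
    assume f: "continuous_map (power_top {m..n}) euclideanreal f" "bounded (f ` topspace
        (power_top {m..n}))"
    have fm: "f \<in> borel_measurable (power_borel {m..n})"
      using f(1) by (rule measurable_continuous_map_power_top)
    have "bounded (range (\<lambda>y. f (restrict y {m..n})))"
      by (rule bounded_subset[OF f(2)]) auto
    with L continuous_map_restrict_coordinates[OF f(1)]
    have "((\<lambda>x. \<integral>y. f (restrict y {m..n}) \<partial>window_law (- int N) (int N) x)
        \<longlongrightarrow> (\<integral>y. f (restrict y {m..n}) \<partial>L)) at_top"
      by (simp add: weak_limit_def)
    moreover have "(\<integral>y. f (restrict y {m..n}) \<partial>window_law (- int N) (int N) x)
      = integral\<^sup>L (law_given_exceedance M (power_borel {m..n}) (\<lambda>\<omega>. \<lambda>t\<in>{m..n}. Y t \<omega> / x) V x) f"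
          for x
      using N by (intro integral_window_law measurable_restrict_coordinates fm)
          (auto simp: window_def)
    moreover have "(\<integral>y. f (restrict y {m..n}) \<partial>L)
        = integral\<^sup>L (distr L (power_borel {m..n}) (\<lambda>y. restrict y {m..n})) f"
      using rm fm by (rule integral_distr[symmetric])
    ultimately show "((\<lambda>x. integral\<^sup>L (law_given_exceedance M (power_borel {m..n})
        (\<lambda>\<omega>. \<lambda>t\<in>{m..n}. Y t \<omega> / x) V x) f)
        \<longlongrightarrow> integral\<^sup>L (distr L (power_borel {m..n}) (\<lambda>y. restrict y {m..n})) f) at_top"
      by simp
  qed simp
  then show ?thesis by blast
qed

text \<open>A limit along all x is the limit along every sequence, so only uniqueness of weak limits
  on the window space remains.\<close>

lemma unique_accumulation_point:
  assumes "no_mass_at_zero"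
  shows "\<exists>!\<nu>. weak_accumulation_point (power_top {m..n}) (power_borel {m..n})
    (\<lambda>x. law_given_exceedance M (power_borel {m..n}) (\<lambda>\<omega>. \<lambda>t\<in>{m..n}. Y t \<omega> / x) V x) \<nu>"
proof -
  obtain L where L: "weak_limit (power_top {m..n}) (power_borel {m..n})
    (\<lambda>x. law_given_exceedance M (power_borel {m..n}) (\<lambda>\<omega>. \<lambda>t\<in>{m..n}. Y t \<omega> / x) V x) L at_top"
    using weak_limit_coordinates[OF assms] by blast
  have seq: "weak_limit (power_top {m..n}) (power_borel {m..n})
    (\<lambda>k. law_given_exceedance M (power_borel {m..n}) (\<lambda>\<omega>. \<lambda>t\<in>{m..n}. Y t \<omega> / X k) V
        (X k)) L sequentially"
    if "filterlim X at_top sequentially" for X :: "nat \<Rightarrow> real"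
    using L filterlim_compose[OF _ that] unfolding weak_limit_def by blast
  show ?thesis
    unfolding weak_accumulation_point_def
  proof (rule ex1I[of _ L])
    show "\<exists>X. filterlim X at_top sequentially \<and> weak_limit (power_top {m..n}) (power_borel {m..n})
      (\<lambda>k. law_given_exceedance M (power_borel {m..n}) (\<lambda>\<omega>. \<lambda>t\<in>{m..n}. Y t \<omega> / X k) V
          (X k)) L sequentially"
      using seq[OF filterlim_real_sequentially] filterlim_real_sequentially by blast
  next
    fix \<nu>
    assume "\<exists>X. filterlim X at_top sequentially \<and> weak_limit (power_top {m..n}) (power_borel {m..n})
      (\<lambda>k. law_given_exceedance M (power_borel {m..n}) (\<lambda>\<omega>. \<lambda>t\<in>{m..n}. Y t \<omega> / X k) V
          (X k)) \<nu> sequentially"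
    then show "\<nu> = L"
      using seq weak_limit_power_unique[OF _ _ trivial_limit_sequentially] by blast
  qed
qed

lemma weak_limit_no_mass_at_zero:
  assumes "no_mass_at_zero"
  shows "\<exists>\<nu>. weak_limit euclidean borel (\<lambda>x. law_given_exceedance M borel
      (\<lambda>\<omega>. Y 0 \<omega> / x) V x) \<nu> at_top
    \<and> measure \<nu> {0} = 0"
proof (intro exI conjI)
  let ?A = "limit_measure 0 0"
  interpret A: prob_space ?A using assms by (intro limit_measure_0_prob) auto
  have m: "(\<lambda>y. y 0) \<in> borel_measurable ?A"
    by (simp cong: measurable_cong_sets)
  show "weak_limit euclidean borel (\<lambda>x. law_given_exceedance M borel (\<lambda>\<omega>. Y 0 \<omega> / x) V x)
      (distr ?A borel (\<lambda>y. y 0)) at_top"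
    unfolding weak_limit_def
  proof (intro conjI allI impI)
    show "prob_space (distr ?A borel (\<lambda>y. y 0))" using m by (rule A.prob_space_distr)
    fix f :: "real \<Rightarrow> real" assume "continuous_map euclidean euclideanreal f" "bounded
        (f ` topspace euclidean)"
    then have f: "continuous_on UNIV f" "bounded (range f)" by auto
    have fm: "f \<in> borel_measurable borel" using f(1) by (rule borel_measurable_continuous_onI)
    have "continuous_on UNIV (\<lambda>y :: int \<Rightarrow> real. f (y 0))"
      by (rule continuous_on_compose2[OF f(1)])
          (auto intro: continuous_on_product_then_coordinatewise)
    moreover have "bounded (range (\<lambda>y :: int \<Rightarrow> real. f (y 0)))"
      by (rule bounded_subset[OF f(2)]) auto
    ultimately have "((\<lambda>x. \<integral>y. f (y 0) \<partial>window_law 0 0 x) \<longlongrightarrow> (\<integral>y. f (y 0) \<partial>?A)) at_top"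
      using weak_limit_window_0[OF _ assms, of 0] by (simp add: weak_limit_def)
    moreover have "(\<integral>y. f (y 0) \<partial>window_law 0 0 x)
        = integral\<^sup>L (law_given_exceedance M borel (\<lambda>\<omega>. Y 0 \<omega> / x) V x) f" for x
      using fm by (intro integral_window_law) (auto simp: window_def)
    moreover have "(\<integral>y. f (y 0) \<partial>?A) = integral\<^sup>L (distr ?A borel (\<lambda>y. y 0)) f"
      using m fm by (rule integral_distr[symmetric])
    ultimately show "((\<lambda>x. integral\<^sup>L (law_given_exceedance M borel (\<lambda>\<omega>. Y 0 \<omega> / x) V x) f)
        \<longlongrightarrow> integral\<^sup>L (distr ?A borel (\<lambda>y. y 0)) f) at_top"
      by simp
  qed simp
  have "AE y in distr ?A borel (\<lambda>y. y 0). y \<noteq> 0"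
    using limit_measure_le_1(1)[of 0 0] m by (subst AE_distr_iff) auto
  then show "measure (distr ?A borel (\<lambda>y. y 0)) {0} = 0"
    using AE_iff_measurable[of "{0}" "distr ?A borel (\<lambda>y. y 0)" "\<lambda>y. y \<noteq> 0"]
        by (simp add: measure_def)
qed

lemma no_mass_at_zero_if_weak_limit:
  assumes L: "weak_limit euclidean borel (\<lambda>x. law_given_exceedance M borel
      (\<lambda>\<omega>. Y 0 \<omega> / x) V x) \<nu> at_top"
    and 0: "measure \<nu> {0} = 0"
  shows "no_mass_at_zero"
  unfolding no_mass_at_zero_def weak_accumulation_point_def
proof (intro exI conjI)
  show "filterlim real at_top sequentially" by (rule filterlim_real_sequentially)
  show "weak_limit euclidean borel (\<lambda>k. law_given_exceedance M borel (\<lambda>\<omega>. Y 0 \<omega> / real k) V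
      (real k)) \<nu> sequentially"
    using L filterlim_compose[OF _ filterlim_real_sequentially] unfolding weak_limit_def by blast
  have \<nu>: "prob_space \<nu>" "sets \<nu> = sets borel" using L by (auto simp: weak_limit_def)
  then interpret N: prob_space \<nu> by simp
  have "{0} \<in> null_sets \<nu>"
    using 0 \<nu>(2) by (auto simp: null_sets_def N.emeasure_eq_measure)
  then show "AE y in \<nu>. y \<noteq> 0"
    using AE_not_in by fastforce
qed

end

section \<open>Instantiation by the hypotheses of the theorem\<close>

lemma heavy_tailed_chain_if_stationary:
  fixes \<epsilon> :: "int \<Rightarrow> 'a \<Rightarrow> 's::{metric_space, second_countable_topology}"
  assumes "prob_space M"
    and Y: "\<And>t. Y t \<in> borel_measurable M" and V: "V \<in> borel_measurable M"
    and "case_prod \<Phi> \<in> borel_measurable (borel \<Otimes>\<^sub>M borel)"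
    and "case_prod \<Psi> \<in> borel_measurable (borel \<Otimes>\<^sub>M power_borel {1..s})"
    and \<epsilon>: "iid M \<epsilon>"
    and "innovations_indep_past M \<epsilon> Y"
    and stat: "stationary M Y"
    and "\<And>t. AE \<omega> in M. Y t \<omega> = \<Phi> (Y (t - 1) \<omega>) (\<epsilon> t \<omega>)"
    and "AE \<omega> in M. V \<omega> = \<Psi> (Y 0 \<omega>) (\<lambda>i\<in>{1..s}. \<epsilon> (int i) \<omega>)"
    and "\<alpha> > 0" "p \<in> {0..1}" "C > 0"
    and "balanced_regularly_varying M (Y 0) \<alpha> p" "balanced_regularly_varying M V \<alpha> p'"
    and "((\<lambda>x. measure M {\<omega> \<in> space M. \<bar>V \<omega>\<bar> > x} / measure M {\<omega> \<in> space M. \<bar>Y 0 \<omega>\<bar> > x}) \<longlongrightarrow> C) at_top"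
    and "scaling_limit euclidean \<Phi> \<phi>" "scaling_limit (power_top {1..s}) \<Psi> \<psi>"
  shows "heavy_tailed_chain M \<epsilon> Y V s \<Phi> \<Psi> \<phi> \<psi> \<alpha> (p / C) ((1 - p) / C)"
proof -
  interpret prob_space M by fact
  interpret Y0: regularly_varying_tails M "Y 0" "\<lambda>x. prob {\<omega> \<in> space M. \<bar>V \<omega>\<bar> > x}" \<alpha> "p / C"
      "(1 - p) / C"
    using assms by (intro balanced_regularly_varying_tails) auto
  have tails: "regularly_varying_tails M (Y t) (\<lambda>x. prob {\<omega> \<in> space M. \<bar>V \<omega>\<bar> > x}) \<alpha> (p / C)
      ((1 - p) / C)" for t
  proof -
    \<comment> \<open>Tail probabilities depend only on the one-dimensional marginal, which
      stationarity makes the same at all times; the constants found at time 0 thus serve every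
      t.\<close>
    have right: "prob {\<omega> \<in> space M. c < Y t \<omega>} = prob {\<omega> \<in> space M. c < Y 0 \<omega>}" for c
      using stationary_prob[OF stat Y, of "{c<..}" t] by simp
    have left: "prob {\<omega> \<in> space M. Y t \<omega> < c} = prob {\<omega> \<in> space M. Y 0 \<omega> < c}" for c
      using stationary_prob[OF stat Y, of "{..<c}" t] by simp
    show ?thesis
    proof (intro regularly_varying_tails.intro regularly_varying_tails_axioms.intro prob_space_axioms)
      fix u :: real assume u: "u > 0"
      show "((\<lambda>x. prob {\<omega> \<in> space M. u * x < Y t \<omega>} / prob {\<omega> \<in> space M. \<bar>V \<omega>\<bar> > x})
          \<longlongrightarrow> p / C * u powr - \<alpha>) at_top"
        unfolding right by (rule Y0.right_tail[OF u])
      show "((\<lambda>x. prob {\<omega> \<in> space M. Y t \<omega> < - (u * x)} / prob {\<omega> \<in> space M. \<bar>V \<omega>\<bar> > x})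
          \<longlongrightarrow> (1 - p) / C * u powr - \<alpha>) at_top"
        unfolding left by (rule Y0.left_tail[OF u])
    qed (rule Y Y0.q Y0.\<alpha> Y0.ab)+
  qed
  have "\<epsilon> t \<in> borel_measurable M" for t
    using \<epsilon> unfolding iid_def indep_vars_def by simp
  then show ?thesis
    by (intro heavy_tailed_chain.intro heavy_tailed_chain_axioms.intro assms tails)
qed

theorem proposition3p1:
  fixes M :: "'a measure"
    and \<epsilon> :: "int \<Rightarrow> 'a \<Rightarrow> 's::{metric_space, second_countable_topology}"
    and Y X :: "int \<Rightarrow> 'a \<Rightarrow> real"
    and s :: nat
    and \<Phi> :: "real \<Rightarrow> 's \<Rightarrow> real"
    and \<Psi> :: "real \<Rightarrow> (nat \<Rightarrow> 's) \<Rightarrow> real"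
    and \<phi> :: "'s \<Rightarrow> real \<Rightarrow> real"
    and \<psi> :: "(nat \<Rightarrow> 's) \<Rightarrow> real \<Rightarrow> real"
    and \<alpha> p p' C :: real
  assumes "prob_space M"
    and "s \<ge> 1"
    and "\<And>t. Y t \<in> borel_measurable M"
    and "\<And>t. X t \<in> borel_measurable M"
    and "case_prod \<Phi> \<in> borel_measurable (borel \<Otimes>\<^sub>M borel)"
    and "case_prod \<Psi> \<in> borel_measurable (borel \<Otimes>\<^sub>M power_borel {1..s})"
    and "iid M \<epsilon>"
    and "innovations_indep_past M \<epsilon> Y"
    and "stationary M Y"
    and "stationary M X"
    and "\<And>t. AE \<omega> in M. Y t \<omega> = \<Phi> (Y (t - 1) \<omega>) (\<epsilon> t \<omega>)"
    and "\<And>t. AE \<omega> in M. X t \<omega> = \<Psi> (Y t \<omega>) (\<lambda>i\<in>{1..s}. \<epsilon> (t + int i) \<omega>)"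
    and "\<alpha> > 0" and "p \<in> {0..1}" and "p' \<in> {0..1}" and "C > 0"
    and "balanced_regularly_varying M (Y 0) \<alpha> p"
    and "balanced_regularly_varying M (X 0) \<alpha> p'"
    and "((\<lambda>x. measure M {\<omega> \<in> space M. \<bar>X 0 \<omega>\<bar> > x} / measure M {\<omega> \<in> space M. \<bar>Y 0 \<omega>\<bar> > x})
            \<longlongrightarrow> C) at_top"
    and "scaling_limit euclidean \<Phi> \<phi>"
    and "scaling_limit (power_top {1..s}) \<Psi> \<psi>"
  shows
    "((\<forall>m n :: int. m \<le> n \<longrightarrow>
         (\<exists>!\<nu>. weak_accumulation_point (power_top {m..n}) (power_borel {m..n})
            (\<lambda>x. law_given_exceedance M (power_borel {m..n}) (\<lambda>\<omega>. \<lambda>t\<in>{m..n}. Y t \<omega> / x) (X 0) x) \<nu>))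
      \<and> (\<exists>\<nu>. weak_limit euclidean borel
               (\<lambda>x. law_given_exceedance M borel (\<lambda>\<omega>. Y 0 \<omega> / x) (X 0) x) \<nu> at_top
             \<and> measure \<nu> {0} = 0))
     \<longleftrightarrow>
     (\<exists>\<nu>. weak_accumulation_point euclidean borel
             (\<lambda>x. law_given_exceedance M borel (\<lambda>\<omega>. Y 0 \<omega> / x) (X 0) x) \<nu>
           \<and> (AE y in \<nu>. y \<noteq> 0))"

proof -
  interpret heavy_tailed_chain M \<epsilon> Y "X 0" s \<Phi> \<Psi> \<phi> \<psi> \<alpha> "p / C" "(1 - p) / C"
    using assms(12)[of 0]
    by (intro heavy_tailed_chain_if_stationary[where p' = p'] assms) simp_all
  show ?thesis
    unfolding no_mass_at_zero_def[symmetric]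
    using unique_accumulation_point weak_limit_no_mass_at_zero no_mass_at_zero_if_weak_limit by blast
qed

end
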